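(* Let $S$ be the unilateral shift on the Hardy space $H^2(\mathbb{D})$ of the unit disk, $(Sf)(z)=zf(z)$, and let $S^*$ be its adjoint, $(S^*f)(z)=(f(z)-f(0))/z$. The operators $S\odot S^*$ and $S\wedge S^*$ are selfadjoint and their point spectra, as multisets with eigenvalues repeated according to multiplicity, are $$\sigma_{\mathrm{p}}(S\odot S^* )=\Big\{\!\!\Big\{\cos\Big(\frac{(2j-1)\pi}{k+2}\Big): k\geq 0,\ 1\leq j\leq\Big\lfloor\frac{k+2}{2}\Big\rfloor\Big\}\!\!\Big\}$$ and $$\sigma_{\mathrm{p}}(S\wedge S^* )=\Big\{\!\!\Big\{\cos\Big(\frac{2j\pi}{k+2}\Big): k\geq 1,\ 1\leq j\leq\Big\lfloor\frac{k+1}{2}\Big\rfloor\Big\}\!\!\Big\},$$ where $k,j$ are integers. Moreover, $$\sigma(S\odot S^* )=\sigma_{\mathrm{ap}}(S\odot S^* )=\sigma(S\wedge S^* )=\sigma_{\mathrm{ap}}(S\wedge S^* )=[-1,1]$$ and $\|S\odot S^*\|=\|S\wedge S^*\|=1$.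
   Context: $\sigma(T)$, $\sigma_{\mathrm{p}}(T)$, $\sigma_{\mathrm{ap}}(T)$ denote the spectrum, point spectrum (set of eigenvalues) and approximate point spectrum of $T$. Double braces denote a multiset: each pair $(k,j)$ contributes one occurrence. For $\mathcal{H}=H^2(\mathbb{D})$ (orthonormal basis $1,z,z^2,\ldots$), let $\mathcal{H}\otimes\mathcal{H}$ be the Hilbert-space tensor product and let $\hat\pi$ be the unitary flip on it, determined by $\hat\pi(\vec{u}\otimes\vec{v})=\vec{v}\otimes\vec{u}$. Put $\mathcal{H}\odot\mathcal{H}=\{\vec{x}\in\mathcal{H}\otimes\mathcal{H}:\hat\pi\vec{x}=\vec{x}\}$ and $\mathcal{H}\wedge\mathcal{H}=\{\vec{x}\in\mathcal{H}\otimes\mathcal{H}:\hat\pi\vec{x}=-\vec{x}\}$, both closed subspaces. For bounded operators $A,B$ on $\mathcal{H}$, $A\otimes B$ is the bounded operator on $\mathcal{H}\otimes\mathcal{H}$ with $(A\otimes B)(\vec{u}\otimes\vec{v})=A\vec{u}\otimes B\vec{v}$. The operators $A\odot B$ and $A\wedge B$ are the restrictions of $\frac{1}{2}(A\otimes B+B\otimes A)$ to $\mathcal{H}\odot\mathcal{H}$ and $\mathcal{H}\wedge\mathcal{H}$, respectively (both subspaces are invariant), regarded as operators on these spaces. *)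

theory Defs
  imports "HOL-Complex_Analysis.Complex_Analysis" "HOL-Library.Extended_Nat"
    "HOL-Library.Nat_Bijection"
begin

section \<open>Complex Hilbert spaces\<close>

class scaleC =
  fixes scaleC :: "complex \<Rightarrow> 'a \<Rightarrow> 'a" (infixr "*\<^sub>C" 75)

class complex_vector = real_vector + scaleC +
  assumes scaleC_add_right: "c *\<^sub>C (x + y) = c *\<^sub>C x + c *\<^sub>C y"
    and scaleC_add_left: "(c + d) *\<^sub>C x = c *\<^sub>C x + d *\<^sub>C x"
    and scaleC_scaleC: "c *\<^sub>C (d *\<^sub>C x) = (c * d) *\<^sub>C x"
    and scaleC_one: "1 *\<^sub>C x = x"
    and scaleR_scaleC: "r *\<^sub>R x = complex_of_real r *\<^sub>C x"

global_interpretation complex_vector: vector_space "scaleC :: complex \<Rightarrow> 'a \<Rightarrow> 'a::complex_vector"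
  defines cspan = complex_vector.span
    and cdim = complex_vector.dim
  by unfold_locales (simp_all add: scaleC_add_right scaleC_add_left scaleC_scaleC scaleC_one)

text \<open>The inner product is linear in the first argument. The norm, being that of the real inner
  product \<open>inner x y = Re (cinner x y)\<close>, is \<open>sqrt (Re (cinner x x))\<close>.\<close>

class complex_inner = complex_vector + real_inner +
  fixes cinner :: "'a \<Rightarrow> 'a \<Rightarrow> complex"
  assumes cinner_commute: "cinner x y = cnj (cinner y x)"
    and cinner_add_left: "cinner (x + y) z = cinner x z + cinner y z"
    and cinner_scaleC_left: "cinner (c *\<^sub>C x) y = c * cinner x y"
    and inner_Re_cinner: "inner x y = Re (cinner x y)"

class complex_hilbert = complex_inner + complete_space

section \<open>Operators on a closed subspace\<close>

text \<open>An operator on a closed subspace \<open>M\<close> is a function on the ambient type of which only the values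
  on \<open>M\<close> matter. The whole space is \<open>M = UNIV\<close>.\<close>

definition bounded_op_on :: "'a::complex_inner set \<Rightarrow> ('a \<Rightarrow> 'a) \<Rightarrow> bool" where
  "bounded_op_on M T \<longleftrightarrow>
     (\<forall>x\<in>M. T x \<in> M) \<and>
     (\<forall>x\<in>M. \<forall>y\<in>M. T (x + y) = T x + T y) \<and>
     (\<forall>c. \<forall>x\<in>M. T (c *\<^sub>C x) = c *\<^sub>C T x) \<and>
     (\<exists>C. \<forall>x\<in>M. norm (T x) \<le> C * norm x)"

definition is_adjoint_on :: "'a::complex_inner set \<Rightarrow> ('a \<Rightarrow> 'a) \<Rightarrow> ('a \<Rightarrow> 'a) \<Rightarrow> bool" where
  "is_adjoint_on M T T' \<longleftrightarrow>
     bounded_op_on M T' \<and> (\<forall>x\<in>M. \<forall>y\<in>M. cinner (T x) y = cinner x (T' y))"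

definition selfadjoint_on :: "'a::complex_inner set \<Rightarrow> ('a \<Rightarrow> 'a) \<Rightarrow> bool" where
  "selfadjoint_on M T \<longleftrightarrow> is_adjoint_on M T T"

definition cadjoint :: "('a::complex_inner \<Rightarrow> 'a) \<Rightarrow> ('a \<Rightarrow> 'a)" where
  "cadjoint T = (THE T'. is_adjoint_on UNIV T T')"

definition op_norm_on :: "'a::complex_inner set \<Rightarrow> ('a \<Rightarrow> 'a) \<Rightarrow> real" where
  "op_norm_on M T = (SUP x\<in>{x\<in>M. norm x \<le> 1}. norm (T x))"

definition spectrum_on :: "'a::complex_inner set \<Rightarrow> ('a \<Rightarrow> 'a) \<Rightarrow> complex set" where
  "spectrum_on M T =
     {\<mu>. \<not> (\<exists>R. bounded_op_on M R \<and>
             (\<forall>x\<in>M. R (T x - \<mu> *\<^sub>C x) = x \<and> T (R x) - \<mu> *\<^sub>C R x = x))}"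

definition approx_point_spectrum_on :: "'a::complex_inner set \<Rightarrow> ('a \<Rightarrow> 'a) \<Rightarrow> complex set" where
  "approx_point_spectrum_on M T =
     {\<mu>. \<exists>x :: nat \<Rightarrow> 'a. (\<forall>n. x n \<in> M \<and> norm (x n) = 1) \<and>
          (\<lambda>n. T (x n) - \<mu> *\<^sub>C x n) \<longlonglongrightarrow> 0}"

definition eigenspace_on :: "'a::complex_inner set \<Rightarrow> ('a \<Rightarrow> 'a) \<Rightarrow> complex \<Rightarrow> 'a set" where
  "eigenspace_on M T \<mu> = {x\<in>M. T x = \<mu> *\<^sub>C x}"

section \<open>Multisets with possibly infinite multiplicities\<close>

text \<open>Eigenvalues may have infinite multiplicity, so a multiset of complex numbers is represented by
  its multiplicity function with values in the extended natural numbers.\<close>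

type_synonym 'a emultiset = "'a \<Rightarrow> enat"

definition ecard :: "'a set \<Rightarrow> enat" where
  "ecard A = (if finite A then enat (card A) else \<infinity>)"

definition edim :: "'a::complex_vector set \<Rightarrow> enat" where
  "edim V = (if \<exists>B. finite B \<and> cspan B = V then enat (cdim V) else \<infinity>)"

text \<open>The multiset of all \<open>f i\<close>, each index \<open>i \<in> I\<close> contributing one occurrence.\<close>

definition family_emultiset :: "'i set \<Rightarrow> ('i \<Rightarrow> 'a) \<Rightarrow> 'a emultiset" where
  "family_emultiset I f = (\<lambda>a. ecard {i\<in>I. f i = a})"

text \<open>The number \<open>\<mu>\<close> occurs in the point spectrum iff its eigenspace is nonzero, and then as often
  as the dimension of the eigenspace says.\<close>

definition point_spectrum_on :: "'a::complex_inner set \<Rightarrow> ('a \<Rightarrow> 'a) \<Rightarrow> complex emultiset" where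
  "point_spectrum_on M T = (\<lambda>\<mu>. edim (eigenspace_on M T \<mu>))"

section \<open>Hilbert-space tensor square\<close>

text \<open>\<open>t u v\<close> is the elementary tensor of \<open>u\<close> and \<open>v\<close>. These properties determine the Hilbert space
  \<open>'k\<close> together with \<open>t\<close> up to a unique unitary isomorphism.\<close>

definition hilbert_tensor :: "('a::complex_inner \<Rightarrow> 'a \<Rightarrow> 'k::complex_hilbert) \<Rightarrow> bool" where
  "hilbert_tensor t \<longleftrightarrow>
     (\<forall>u u' v. t (u + u') v = t u v + t u' v) \<and>
     (\<forall>u v v'. t u (v + v') = t u v + t u v') \<and>
     (\<forall>c u v. t (c *\<^sub>C u) v = c *\<^sub>C t u v) \<and>
     (\<forall>c u v. t u (c *\<^sub>C v) = c *\<^sub>C t u v) \<and>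
     (\<forall>u v u' v'. cinner (t u v) (t u' v') = cinner u u' * cinner v v') \<and>
     closure (cspan {t u v | u v. True}) = UNIV"

text \<open>A bounded operator is determined by its values on elementary tensors, their span being dense;
  so the descriptions below are unique.\<close>

definition tensor_flip :: "('a::complex_inner \<Rightarrow> 'a \<Rightarrow> 'k::complex_hilbert) \<Rightarrow> 'k \<Rightarrow> 'k" where
  "tensor_flip t = (THE F. bounded_op_on UNIV F \<and> (\<forall>u v. F (t u v) = t v u))"

definition tensor_op ::
  "('a::complex_inner \<Rightarrow> 'a \<Rightarrow> 'k::complex_hilbert) \<Rightarrow> ('a \<Rightarrow> 'a) \<Rightarrow> ('a \<Rightarrow> 'a) \<Rightarrow> 'k \<Rightarrow> 'k" where
  "tensor_op t A B = (THE T. bounded_op_on UNIV T \<and> (\<forall>u v. T (t u v) = t (A u) (B v)))"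

definition sym_space :: "('a::complex_inner \<Rightarrow> 'a \<Rightarrow> 'k::complex_hilbert) \<Rightarrow> 'k set" where
  "sym_space t = {x. tensor_flip t x = x}"

definition alt_space :: "('a::complex_inner \<Rightarrow> 'a \<Rightarrow> 'k::complex_hilbert) \<Rightarrow> 'k set" where
  "alt_space t = {x. tensor_flip t x = - x}"

definition tensor_mean ::
  "('a::complex_inner \<Rightarrow> 'a \<Rightarrow> 'k::complex_hilbert) \<Rightarrow> ('a \<Rightarrow> 'a) \<Rightarrow> ('a \<Rightarrow> 'a) \<Rightarrow> 'k \<Rightarrow> 'k" where
  "tensor_mean t A B x = (1 / 2) *\<^sub>C (tensor_op t A B x + tensor_op t B A x)"

definition sym_tensor_op ::
  "('a::complex_inner \<Rightarrow> 'a \<Rightarrow> 'k::complex_hilbert) \<Rightarrow> ('a \<Rightarrow> 'a) \<Rightarrow> ('a \<Rightarrow> 'a) \<Rightarrow> 'k \<Rightarrow> 'k" where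
  "sym_tensor_op t A B = restrict (tensor_mean t A B) (sym_space t)"

definition alt_tensor_op ::
  "('a::complex_inner \<Rightarrow> 'a \<Rightarrow> 'k::complex_hilbert) \<Rightarrow> ('a \<Rightarrow> 'a) \<Rightarrow> ('a \<Rightarrow> 'a) \<Rightarrow> 'k \<Rightarrow> 'k" where
  "alt_tensor_op t A B = restrict (tensor_mean t A B) (alt_space t)"

section \<open>The Hardy space of the unit disk\<close>

abbreviation taylor :: "(complex \<Rightarrow> complex) \<Rightarrow> nat \<Rightarrow> complex" where
  "taylor f n \<equiv> fps_nth (fps_expansion f 0) n"

text \<open>HOL functions are total, so functions on the disk are represented by their extension by \<open>0\<close>.\<close>

definition hardy_set :: "(complex \<Rightarrow> complex) set" where
  "hardy_set = {f. f holomorphic_on ball 0 1 \<and> (\<forall>z. z \<notin> ball 0 1 \<longrightarrow> f z = 0) \<and>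
                   summable (\<lambda>n. (norm (taylor f n))\<^sup>2)}"

lemma hardy_sums:
  assumes "f \<in> hardy_set" "norm z < 1"
  shows "(\<lambda>n. taylor f n * z ^ n) sums f z"
  using holomorphic_power_series[of f 0 1 z] assms
  by (simp add: hardy_set_def fps_expansion_def)

lemma hardy_intro:
  assumes s: "\<And>z. norm z < 1 \<Longrightarrow> (\<lambda>n. a n * z ^ n) sums f z"
    and z: "\<And>z. norm z \<ge> 1 \<Longrightarrow> f z = 0"
    and a: "summable (\<lambda>n. (norm (a n))\<^sup>2)"
  shows hardy_introI: "f \<in> hardy_set" and hardy_intro_taylor: "taylor f = a"
proof -
  have h: "f holomorphic_on ball 0 1"
    by (rule power_series_holomorphic[where a = a]) (use s in auto)
  have "f has_fps_expansion Abs_fps a"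
  proof (rule has_fps_expansionI)
    have "eventually (\<lambda>z::complex. z \<in> ball 0 1) (nhds 0)"
      by (rule eventually_nhds_in_open) auto
    then show "\<forall>\<^sub>F u in nhds 0. (\<lambda>n. fps_nth (Abs_fps a) n * u ^ n) sums f u"
      by eventually_elim (use s in auto)
  qed
  moreover have "f has_fps_expansion fps_expansion f 0"
  proof (rule has_fps_expansionI)
    have "eventually (\<lambda>z::complex. z \<in> ball 0 1) (nhds 0)"
      by (rule eventually_nhds_in_open) auto
    then show "\<forall>\<^sub>F u in nhds 0. (\<lambda>n. taylor f n * u ^ n) sums f u"
      by eventually_elim
        (use holomorphic_power_series[OF h] in \<open>auto simp: fps_expansion_def\<close>)
  qed
  ultimately have "Abs_fps a = fps_expansion f 0"
    by (rule fps_expansion_unique_complex)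
  from this[symmetric] have t: "taylor f n = a n" for n by simp
  then show "taylor f = a" by (intro ext)
  show "f \<in> hardy_set" using h z a by (simp add: hardy_set_def t)
qed

lemma sq_summable_add:
  fixes a b :: "nat \<Rightarrow> complex"
  assumes "summable (\<lambda>n. (norm (a n))\<^sup>2)" "summable (\<lambda>n. (norm (b n))\<^sup>2)"
  shows "summable (\<lambda>n. (norm (a n + b n))\<^sup>2)"
proof (rule summable_comparison_test'[where N = 0])
  show "summable (\<lambda>n. 2 * (norm (a n))\<^sup>2 + 2 * (norm (b n))\<^sup>2)"
    using assms by (intro summable_add summable_mult)
  fix n
  have "(norm (a n + b n))\<^sup>2 \<le> (norm (a n) + norm (b n))\<^sup>2"
    by (intro power_mono norm_triangle_ineq) auto
  also have "\<dots> \<le> 2 * (norm (a n))\<^sup>2 + 2 * (norm (b n))\<^sup>2"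
    using sum_squares_bound[of "norm (a n)" "norm (b n)"] by (simp add: power2_sum)
  finally show "norm ((norm (a n + b n))\<^sup>2) \<le> 2 * (norm (a n))\<^sup>2 + 2 * (norm (b n))\<^sup>2" by simp
qed

lemma sq_summable_mult:
  fixes a b :: "nat \<Rightarrow> complex"
  assumes "summable (\<lambda>n. (norm (a n))\<^sup>2)" "summable (\<lambda>n. (norm (b n))\<^sup>2)"
  shows "summable (\<lambda>n. norm (a n * b n))"
proof (rule summable_comparison_test'[where N = 0])
  show "summable (\<lambda>n. (norm (a n))\<^sup>2 + (norm (b n))\<^sup>2)"
    using assms by (intro summable_add)
  fix n
  show "norm (norm (a n * b n)) \<le> (norm (a n))\<^sup>2 + (norm (b n))\<^sup>2"
    using sum_squares_bound[of "norm (a n)" "norm (b n)"]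
      mult_nonneg_nonneg[OF norm_ge_zero[of "a n"] norm_ge_zero[of "b n"]]
    unfolding norm_mult real_norm_def abs_mult abs_norm_cancel mult.assoc by linarith
qed

lemma sq_summable_cmult:
  fixes a :: "nat \<Rightarrow> complex"
  assumes "summable (\<lambda>n. (norm (a n))\<^sup>2)"
  shows "summable (\<lambda>n. (norm (c * a n))\<^sup>2)"
  using assms by (simp add: norm_mult power_mult_distrib summable_mult)

lemma hardy_zero: "(\<lambda>z. 0) \<in> hardy_set"
  by (rule hardy_introI[where a = "\<lambda>_. 0"]) auto

typedef hardy = hardy_set
  using hardy_zero by blast

definition hcoeff :: "hardy \<Rightarrow> nat \<Rightarrow> complex" where
  "hcoeff f = taylor (Rep_hardy f)"

lemma hcoeff_summable: "summable (\<lambda>n. (norm (hcoeff f n))\<^sup>2)"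
  using Rep_hardy[of f] by (simp add: hardy_set_def hcoeff_def)

lemma hcoeff_sums: "norm z < 1 \<Longrightarrow> (\<lambda>n. hcoeff f n * z ^ n) sums Rep_hardy f z"
  using hardy_sums[OF Rep_hardy] by (simp add: hcoeff_def)

lemma Rep_hardy_outside: "norm z \<ge> 1 \<Longrightarrow> Rep_hardy f z = 0"
  using Rep_hardy[of f] by (simp add: hardy_set_def)

lemma hardy_eqI:
  assumes "\<And>n. hcoeff f n = hcoeff g n"
  shows "f = g"
proof -
  have "Rep_hardy f z = Rep_hardy g z" for z
  proof (cases "norm z < 1")
    case True
    show ?thesis
      by (rule sums_unique2[OF hcoeff_sums[OF True]]) (use hcoeff_sums[OF True, of g] assms in simp)
  qed (simp add: Rep_hardy_outside)
  then show ?thesis by (simp add: Rep_hardy_inject[symmetric] ext)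
qed

lemma hardy_Abs:
  assumes "\<And>z. norm z < 1 \<Longrightarrow> (\<lambda>n. a n * z ^ n) sums f z"
    and "\<And>z. norm z \<ge> 1 \<Longrightarrow> f z = 0"
    and "summable (\<lambda>n. (norm (a n))\<^sup>2)"
  shows hardy_Rep_Abs: "Rep_hardy (Abs_hardy f) = f" and hardy_hcoeff_Abs: "hcoeff (Abs_hardy f) = a"
  using hardy_intro[OF assms] by (simp_all add: Abs_hardy_inverse hcoeff_def)

lemma hardy_exists:
  assumes a: "summable (\<lambda>n. (norm (a n))\<^sup>2)"
  shows "\<exists>f. hcoeff f = a"
proof -
  have "(\<lambda>n. norm (a n)) \<longlonglongrightarrow> 0"
    using summable_LIMSEQ_zero[OF a] tendsto_real_sqrt[of "\<lambda>n. (norm (a n))\<^sup>2" 0] by simp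
  then obtain C where C: "\<And>n. norm (a n) \<le> C"
    using convergent_imp_Bseq[of "\<lambda>n. norm (a n)"] unfolding convergent_def Bseq_def by auto
  have s: "summable (\<lambda>n. a n * z ^ n)" if "norm z < 1" for z
  proof (rule summable_comparison_test'[where N = 0])
    show "summable (\<lambda>n. C * norm z ^ n)"
      using that by (intro summable_mult summable_geometric) auto
    show "norm (a n * z ^ n) \<le> C * norm z ^ n" for n
      using C by (simp add: norm_mult norm_power mult_right_mono)
  qed
  show ?thesis
    by (rule exI, rule hardy_hcoeff_Abs[where f = "\<lambda>z. if norm z < 1 then \<Sum>n. a n * z ^ n else 0"])
      (use s a in \<open>auto intro: summable_sums\<close>)
qed

instantiation hardy :: complex_vector
begin

definition zero_hardy :: hardy where "0 = Abs_hardy (\<lambda>z. 0)"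
definition plus_hardy :: "hardy \<Rightarrow> hardy \<Rightarrow> hardy" where
  "f + g = Abs_hardy (\<lambda>z. Rep_hardy f z + Rep_hardy g z)"
definition scaleC_hardy :: "complex \<Rightarrow> hardy \<Rightarrow> hardy" where
  "c *\<^sub>C f = Abs_hardy (\<lambda>z. c * Rep_hardy f z)"
definition uminus_hardy :: "hardy \<Rightarrow> hardy" where "- f = (- 1) *\<^sub>C f" for f :: hardy
definition minus_hardy :: "hardy \<Rightarrow> hardy \<Rightarrow> hardy" where "f - g = f + (- g)" for f g :: hardy
definition scaleR_hardy :: "real \<Rightarrow> hardy \<Rightarrow> hardy" where
  "r *\<^sub>R f = complex_of_real r *\<^sub>C f" for f :: hardy

lemma hcoeff_zero [simp]: "hcoeff 0 n = 0"
  unfolding zero_hardy_def by (subst hardy_hcoeff_Abs[where a = "\<lambda>_. 0"]) auto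

lemma
  shows hcoeff_add [simp]: "hcoeff (f + g) n = hcoeff f n + hcoeff g n"
    and Rep_hardy_add: "Rep_hardy (f + g) z = Rep_hardy f z + Rep_hardy g z"
proof -
  have 1: "(\<lambda>n. (hcoeff f n + hcoeff g n) * z ^ n) sums (Rep_hardy f z + Rep_hardy g z)"
    if "norm z < 1" for z
    using sums_add[OF hcoeff_sums[OF that] hcoeff_sums[OF that]] by (simp only: distrib_right)
  have 2: "Rep_hardy f z + Rep_hardy g z = 0" if "norm z \<ge> 1" for z
    by (simp only: Rep_hardy_outside[OF that] add_0)
  note 3 = sq_summable_add[OF hcoeff_summable hcoeff_summable]
  show "hcoeff (f + g) n = hcoeff f n + hcoeff g n"
    unfolding plus_hardy_def by (simp only: hardy_hcoeff_Abs[OF 1 2 3])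
  show "Rep_hardy (f + g) z = Rep_hardy f z + Rep_hardy g z"
    unfolding plus_hardy_def by (simp only: hardy_Rep_Abs[OF 1 2 3])
qed

lemma
  shows hcoeff_scaleC [simp]: "hcoeff (c *\<^sub>C f) n = c * hcoeff f n"
    and Rep_hardy_scaleC: "Rep_hardy (c *\<^sub>C f) z = c * Rep_hardy f z"
proof -
  have 1: "(\<lambda>n. (c * hcoeff f n) * z ^ n) sums (c * Rep_hardy f z)"
    if "norm z < 1" for z
    using sums_mult[OF hcoeff_sums[OF that]] by (simp only: mult.assoc)
  have 2: "c * Rep_hardy f z = 0" if "norm z \<ge> 1" for z
    by (simp only: Rep_hardy_outside[OF that] mult_zero_right)
  note 3 = sq_summable_cmult[OF hcoeff_summable]
  show "hcoeff (c *\<^sub>C f) n = c * hcoeff f n"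
    unfolding scaleC_hardy_def by (simp only: hardy_hcoeff_Abs[OF 1 2 3])
  show "Rep_hardy (c *\<^sub>C f) z = c * Rep_hardy f z"
    unfolding scaleC_hardy_def by (simp only: hardy_Rep_Abs[OF 1 2 3])
qed

instance
  by standard
    (auto intro!: hardy_eqI simp: uminus_hardy_def minus_hardy_def scaleR_hardy_def algebra_simps)

end

lemma hcoeff_uminus [simp]: "hcoeff (- f) n = - hcoeff f n"
  unfolding uminus_hardy_def hcoeff_scaleC by simp

lemma hcoeff_diff [simp]: "hcoeff (f - g) n = hcoeff f n - hcoeff g n"
  unfolding minus_hardy_def hcoeff_add hcoeff_uminus by simp

lemma hcoeff_mult_summable: "summable (\<lambda>n. hcoeff f n * cnj (hcoeff g n))"
  by (rule summable_norm_cancel, rule sq_summable_mult) (simp_all add: hcoeff_summable)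

instantiation hardy :: complex_inner
begin

definition cinner_hardy :: "hardy \<Rightarrow> hardy \<Rightarrow> complex" where
  "cinner_hardy f g = (\<Sum>n. hcoeff f n * cnj (hcoeff g n))"
definition inner_hardy :: "hardy \<Rightarrow> hardy \<Rightarrow> real" where
  "inner_hardy f g = Re (cinner f g)"
definition norm_hardy :: "hardy \<Rightarrow> real" where "norm_hardy f = sqrt (inner f f)"
definition dist_hardy :: "hardy \<Rightarrow> hardy \<Rightarrow> real" where "dist_hardy f g = norm (f - g)"
definition sgn_hardy :: "hardy \<Rightarrow> hardy" where "sgn_hardy f = f /\<^sub>R norm f"
definition uniformity_hardy :: "(hardy \<times> hardy) filter" where
  "uniformity_hardy = (INF e\<in>{0<..}. principal {(x, y). dist x y < e})"
definition open_hardy :: "hardy set \<Rightarrow> bool" where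
  "open_hardy U = (\<forall>x\<in>U. \<forall>\<^sub>F (x', y) in uniformity. x' = x \<longrightarrow> y \<in> U)"

lemma cinner_hardy_self: "cinner f f = complex_of_real (\<Sum>n. (norm (hcoeff f n))\<^sup>2)"
  unfolding cinner_hardy_def complex_norm_square[symmetric] by (rule suminf_of_real[OF hcoeff_summable, symmetric])

instance
proof
  fix f g h :: hardy and c :: complex and r :: real
  show c: "cinner f g = cnj (cinner g f)" for f g :: hardy
  proof -
    have "(\<lambda>n. cnj (hcoeff g n * cnj (hcoeff f n))) sums cnj (cinner g f)"
      unfolding cinner_hardy_def by (rule sums_cnj[THEN iffD2, OF summable_sums[OF hcoeff_mult_summable]])
    moreover have "cnj (hcoeff g n * cnj (hcoeff f n)) = hcoeff f n * cnj (hcoeff g n)" for n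
      by (simp only: complex_cnj_mult complex_cnj_cnj mult.commute)
    ultimately show ?thesis unfolding cinner_hardy_def[of f g] by (simp only: sums_iff)
  qed
  show a: "cinner (f + g) h = cinner f h + cinner g h" for f g h :: hardy
    unfolding cinner_hardy_def
    by (subst suminf_add[OF hcoeff_mult_summable hcoeff_mult_summable]) (simp only: hcoeff_add distrib_right)
  show m: "cinner (c *\<^sub>C f) g = c * cinner f g" for c and f g :: hardy
    unfolding cinner_hardy_def
    by (subst suminf_mult[OF hcoeff_mult_summable, symmetric]) (simp only: hcoeff_scaleC mult.assoc)
  show "inner f g = Re (cinner f g)" by (simp add: inner_hardy_def)
  show "inner f g = inner g f"
    unfolding inner_hardy_def c[of f g] by (rule cnj.sel(1))
  show "inner (f + g) h = inner f h + inner g h" unfolding inner_hardy_def a by simp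
  show "inner (r *\<^sub>R f) g = r * inner f g" unfolding inner_hardy_def scaleR_scaleC m by simp
  show "0 \<le> inner f f" unfolding inner_hardy_def cinner_hardy_self
    by (simp add: suminf_nonneg hcoeff_summable)
  show "inner f f = 0 \<longleftrightarrow> f = 0"
    unfolding inner_hardy_def cinner_hardy_self
    by (auto simp: suminf_eq_zero_iff[OF hcoeff_summable] intro: hardy_eqI)
qed (rule norm_hardy_def dist_hardy_def sgn_hardy_def uniformity_hardy_def open_hardy_def)+

end

lemma norm_hardy_sq: "(norm f)\<^sup>2 = (\<Sum>n. (norm (hcoeff f n))\<^sup>2)" for f :: hardy
  unfolding power2_norm_eq_inner[of f] inner_Re_cinner[of f f] cinner_hardy_self by (rule Re_complex_of_real)

lemma norm_hcoeff_le_partial: "(\<Sum>n<N. (norm (hcoeff f n))\<^sup>2) \<le> (norm f)\<^sup>2"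
  unfolding norm_hardy_sq by (rule sum_le_suminf) (auto simp: hcoeff_summable)

instance hardy :: complex_hilbert
proof
  fix X :: "nat \<Rightarrow> hardy"
  assume X: "Cauchy X"
  have le: "norm (hcoeff f n) \<le> norm f" for f n
  proof -
    have "(norm (hcoeff f n))\<^sup>2 \<le> (\<Sum>k<Suc n. (norm (hcoeff f k))\<^sup>2)"
      by (rule member_le_sum) auto
    also have "\<dots> \<le> (norm f)\<^sup>2" by (rule norm_hcoeff_le_partial)
    finally show ?thesis by (rule power2_le_imp_le) simp
  qed
  have "Cauchy (\<lambda>k. hcoeff (X k) n)" for n
    unfolding Cauchy_def
  proof (intro allI impI)
    fix e :: real assume "e > 0"
    then obtain M where M: "\<And>k l. k \<ge> M \<Longrightarrow> l \<ge> M \<Longrightarrow> dist (X k) (X l) < e"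
      using metric_CauchyD[OF X, of e] by auto
    have "dist (hcoeff (X k) n) (hcoeff (X l) n) \<le> dist (X k) (X l)" for k l
      using le[of "X k - X l" n] by (simp add: dist_norm)
    with M show "\<exists>M. \<forall>k\<ge>M. \<forall>l\<ge>M. dist (hcoeff (X k) n) (hcoeff (X l) n) < e"
      by (metis le_less_trans)
  qed
  then have "\<forall>n. \<exists>l. (\<lambda>k. hcoeff (X k) n) \<longlonglongrightarrow> l"
    unfolding Cauchy_convergent_iff convergent_def by blast
  then obtain a where a: "\<And>n. (\<lambda>k. hcoeff (X k) n) \<longlonglongrightarrow> a n" by metis
  have tail: "(\<Sum>n<N. (norm (hcoeff (X k) n - a n))\<^sup>2) \<le> e\<^sup>2"
    if M: "\<And>l. l \<ge> M \<Longrightarrow> dist (X k) (X l) \<le> e" and e: "e \<ge> 0" for e M N k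
  proof (rule LIMSEQ_le_const2)
    show "(\<lambda>l. \<Sum>n<N. (norm (hcoeff (X k) n - hcoeff (X l) n))\<^sup>2)
        \<longlonglongrightarrow> (\<Sum>n<N. (norm (hcoeff (X k) n - a n))\<^sup>2)"
      by (intro tendsto_intros a)
    show "\<exists>M. \<forall>l\<ge>M. (\<Sum>n<N. (norm (hcoeff (X k) n - hcoeff (X l) n))\<^sup>2) \<le> e\<^sup>2"
    proof (intro exI allI impI)
      fix l assume "l \<ge> M"
      have "(\<Sum>n<N. (norm (hcoeff (X k) n - hcoeff (X l) n))\<^sup>2) \<le> (norm (X k - X l))\<^sup>2"
        using norm_hcoeff_le_partial[of "X k - X l" N] by simp
      also have "\<dots> \<le> e\<^sup>2" using M[OF \<open>l \<ge> M\<close>] by (intro power_mono) (auto simp: dist_norm)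
      finally show "(\<Sum>n<N. (norm (hcoeff (X k) n - hcoeff (X l) n))\<^sup>2) \<le> e\<^sup>2" .
    qed
  qed
  have summ: "summable (\<lambda>n. (norm (hcoeff (X k) n - a n))\<^sup>2)"
    if "\<And>l. l \<ge> M \<Longrightarrow> dist (X k) (X l) \<le> e" "e \<ge> 0" for e M k
    by (rule summableI_nonneg_bounded[OF _ tail[OF that]]) auto
  obtain M where M: "\<And>k l. k \<ge> M \<Longrightarrow> l \<ge> M \<Longrightarrow> dist (X k) (X l) < 1"
    using metric_CauchyD[OF X, of 1] by auto
  have "summable (\<lambda>n. (norm (hcoeff (- X M) n + (hcoeff (X M) n - a n)))\<^sup>2)"
    by (rule sq_summable_add[OF hcoeff_summable summ[of M M 1]]) (use less_imp_le[OF M] in auto)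
  then have "summable (\<lambda>n. (norm (a n))\<^sup>2)" by simp
  then obtain f where f: "hcoeff f = a" using hardy_exists by blast
  have "X \<longlonglongrightarrow> f"
  proof (rule metric_LIMSEQ_I)
    fix r :: real assume r: "r > 0"
    then obtain M where M: "\<And>k l. k \<ge> M \<Longrightarrow> l \<ge> M \<Longrightarrow> dist (X k) (X l) < r / 2"
      using metric_CauchyD[OF X, of "r / 2"] by auto
    have "dist (X k) f < r" if k: "k \<ge> M" for k
    proof -
      have M': "\<And>l. l \<ge> M \<Longrightarrow> dist (X k) (X l) \<le> r / 2" using less_imp_le[OF M[OF k]] by auto
      have "(norm (X k - f))\<^sup>2 \<le> (r / 2)\<^sup>2"
        unfolding norm_hardy_sq hcoeff_diff f
        by (rule suminf_le_const[OF summ[OF M'] tail[OF M']]) (use r in auto)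
      then have "norm (X k - f) \<le> r / 2" by (rule power2_le_imp_le) (use r in auto)
      then show ?thesis using r by (simp add: dist_norm)
    qed
    then show "\<exists>M. \<forall>k\<ge>M. dist (X k) f < r" by blast
  qed
  then show "convergent X" by (auto simp: convergent_def)
qed

section \<open>The unilateral shift\<close>

definition shift :: "hardy \<Rightarrow> hardy" where
  "shift f = Abs_hardy (\<lambda>z. z * Rep_hardy f z)"

lemma shift_aux:
  shows Rep_hardy_shift: "Rep_hardy (shift f) z = z * Rep_hardy f z"
    and hcoeff_shift: "hcoeff (shift f) n = (case n of 0 \<Rightarrow> 0 | Suc m \<Rightarrow> hcoeff f m)"
proof -
  let ?a = "\<lambda>n. case n of 0 \<Rightarrow> 0 | Suc m \<Rightarrow> hcoeff f m"
  have 1: "(\<lambda>n. ?a n * z ^ n) sums (z * Rep_hardy f z)" if "norm z < 1" for z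
  proof -
    have "(\<lambda>n. ?a (Suc n) * z ^ Suc n) sums (z * Rep_hardy f z)"
      using sums_mult[OF hcoeff_sums[OF that, of f], of z] by (simp add: mult_ac)
    then show ?thesis by (subst (asm) sums_Suc_iff) simp
  qed
  have 2: "summable (\<lambda>n. (norm (?a n))\<^sup>2)"
    by (subst summable_Suc_iff[symmetric]) (simp add: hcoeff_summable)
  show "Rep_hardy (shift f) z = z * Rep_hardy f z" "hcoeff (shift f) n = ?a n"
    unfolding shift_def by (subst hardy_Abs[OF 1 _ 2]; simp add: Rep_hardy_outside)+
qed

lemma cinner_left_eqI:
  fixes y z :: "'a::complex_inner"
  assumes "\<And>x. cinner x y = cinner x z"
  shows "y = z"
proof -
  have "cinner y x = cinner z x" for x
    unfolding cinner_commute[of y x] cinner_commute[of z x] assms ..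
  then have "cinner (y - z) (y - z) = 0"
    using cinner_add_left[of "y - z" z "y - z"] by simp
  then have "inner (y - z) (y - z) = 0" by (simp only: inner_Re_cinner[of "y - z"] zero_complex.sel)
  then show ?thesis by simp
qed

lemma cadjoint_eqI:
  assumes "is_adjoint_on UNIV T T'"
  shows "cadjoint T = T'"
  unfolding cadjoint_def
proof (rule the_equality, rule assms)
  fix T'' assume "is_adjoint_on UNIV T T''"
  with assms have "cinner x (T'' y) = cinner x (T' y)" for x y
    unfolding is_adjoint_on_def by simp
  then show "T'' = T'" by (intro ext cinner_left_eqI)
qed

lemma
  shows hcoeff_cadjoint_shift: "hcoeff (cadjoint shift f) n = hcoeff f (Suc n)"
    and Rep_hardy_cadjoint_shift: "norm z < 1 \<Longrightarrow> z \<noteq> 0 \<Longrightarrow>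
      Rep_hardy (cadjoint shift f) z = (Rep_hardy f z - Rep_hardy f 0) / z"
proof -
  have ss: "summable (\<lambda>n. (norm (hcoeff f (Suc n)))\<^sup>2)" for f
    using hcoeff_summable[of f] by (subst summable_Suc_iff)
  define B where "B f = (SOME g. hcoeff g = (\<lambda>n. hcoeff f (Suc n)))" for f
  have "hcoeff (B f) = (\<lambda>n. hcoeff f (Suc n))" for f
    unfolding B_def by (rule someI_ex, rule hardy_exists, rule ss)
  then have B: "hcoeff (B f) n = hcoeff f (Suc n)" for f n by simp
  have "norm (B f) \<le> 1 * norm f" for f
  proof -
    have "(\<Sum>n. (norm (hcoeff f (Suc n)))\<^sup>2) =
        (\<Sum>n. (norm (hcoeff f n))\<^sup>2) - (norm (hcoeff f 0))\<^sup>2"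
      by (rule suminf_split_head[OF hcoeff_summable])
    then have "(norm (B f))\<^sup>2 \<le> (norm f)\<^sup>2"
      unfolding norm_hardy_sq B by (simp only: diff_le_eq le_add_same_cancel1 zero_le_power2)
    then have "norm (B f) \<le> norm f" by (rule power2_le_imp_le) (rule norm_ge_zero)
    then show ?thesis by (simp only: mult_1)
  qed
  then have "\<exists>C. \<forall>f. norm (B f) \<le> C * norm f" by blast
  moreover have "B (f + g) = B f + B g" "B (c *\<^sub>C f) = c *\<^sub>C B f" for f g c
    by (rule hardy_eqI, simp add: B)+
  moreover have "cinner (shift f) g = cinner f (B g)" for f g
  proof -
    have "(\<Sum>n. hcoeff (shift f) (Suc n) * cnj (hcoeff g (Suc n))) =
        (\<Sum>n. hcoeff (shift f) n * cnj (hcoeff g n)) - hcoeff (shift f) 0 * cnj (hcoeff g 0)"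
      by (rule suminf_split_head[OF hcoeff_mult_summable])
    moreover have "hcoeff (shift f) 0 = 0" "hcoeff (shift f) (Suc n) = hcoeff f n" for n
      by (simp_all only: hcoeff_shift nat.case)
    ultimately show ?thesis
      unfolding cinner_hardy_def B by (simp only: mult_zero_left diff_0_right)
  qed
  ultimately have "is_adjoint_on UNIV shift B"
    by (simp add: is_adjoint_on_def bounded_op_on_def)
  then have eq: "cadjoint shift = B" by (rule cadjoint_eqI)
  show "hcoeff (cadjoint shift f) n = hcoeff f (Suc n)" by (simp only: eq B)
  assume z: "norm z < 1" "z \<noteq> 0"
  have f0: "Rep_hardy f 0 = hcoeff f 0"
    using hcoeff_sums[of 0 f] by (simp add: powser_sums_zero_iff)
  have "(\<lambda>n. hcoeff f (Suc n) * z ^ Suc n) sums (Rep_hardy f z - Rep_hardy f 0)"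
    unfolding f0 using hcoeff_sums[OF z(1), of f] by (subst sums_Suc_iff) simp
  moreover have "(\<lambda>n. hcoeff f (Suc n) * z ^ Suc n) sums (z * Rep_hardy (B f) z)"
    using sums_mult[OF hcoeff_sums[OF z(1), of "B f"], of z] by (simp add: B mult_ac)
  ultimately have "Rep_hardy f z - Rep_hardy f 0 = z * Rep_hardy (B f) z"
    by (rule sums_unique2)
  then show "Rep_hardy (cadjoint shift f) z = (Rep_hardy f z - Rep_hardy f 0) / z"
    using z(2) by (simp add: eq)
qed

section \<open>Existence of the tensor square\<close>

lemma prod_decode_sums:
  fixes a b :: "nat \<Rightarrow> 'a::{banach, real_normed_field}"
  assumes a: "summable (\<lambda>n. norm (a n))" and b: "summable (\<lambda>n. norm (b n))"
  shows prod_decode_summable: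
      "summable (\<lambda>k. norm (a (fst (prod_decode k)) * b (snd (prod_decode k))))"
    and prod_decode_suminf:
      "(\<Sum>k. a (fst (prod_decode k)) * b (snd (prod_decode k))) = (\<Sum>n. a n) * (\<Sum>n. b n)"
proof -
  define F where "F = (\<lambda>(m, n). a m * b n)"
  have s: "infsum c UNIV = suminf c" if "summable (\<lambda>n. norm (c n))" for c :: "nat \<Rightarrow> 'a"
    by (rule infsumI[OF norm_summable_imp_has_sum[OF that]])
      (rule summable_sums[OF summable_norm_cancel[OF that]])
  have a': "(\<lambda>n. norm (a n)) summable_on UNIV" and b': "(\<lambda>n. norm (b n)) summable_on UNIV"
    using a b by (simp_all add: summable_on_UNIV_nonneg_real_iff)
  have abs: "(\<lambda>x. norm (F x)) summable_on UNIV \<times> UNIV"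
  proof (rule Infinite_Sum.abs_summable_on_Sigma_iff[THEN iffD2], intro conjI ballI)
    show "(\<lambda>n. norm (F (m, n))) summable_on UNIV" for m
      unfolding F_def prod.case norm_mult by (intro summable_on_cmult_right b')
    have "(\<lambda>m. norm (a m) * infsum (\<lambda>n. norm (b n)) UNIV) summable_on UNIV"
      by (intro summable_on_cmult_left a')
    then show "(\<lambda>m. norm (infsum (\<lambda>n. norm (F (m, n))) UNIV)) summable_on UNIV"
      unfolding F_def prod.case norm_mult infsum_cmult_right'
      by (simp add: infsum_nonneg)
  qed
  have "(\<lambda>k. norm (F (prod_decode k))) summable_on UNIV"
    using abs by (subst summable_on_reindex_bij_betw[OF bij_prod_decode]) simp
  then have n: "summable (\<lambda>k. norm (F (prod_decode k)))"
    by (rule summable_on_imp_summable)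
  then show "summable (\<lambda>k. norm (a (fst (prod_decode k)) * b (snd (prod_decode k))))"
    by (simp add: F_def case_prod_beta)
  have "(\<Sum>k. F (prod_decode k)) = infsum (\<lambda>k. F (prod_decode k)) UNIV"
    by (rule s[OF n, symmetric])
  also have "\<dots> = infsum F (UNIV \<times> UNIV)"
    by (subst infsum_reindex_bij_betw[OF bij_prod_decode]) simp
  also have "\<dots> = infsum (\<lambda>m. infsum (\<lambda>n. F (m, n)) UNIV) UNIV"
    by (rule infsum_Sigma_banach[symmetric]) (rule abs_summable_summable[OF abs])
  also have "\<dots> = (\<Sum>n. a n) * (\<Sum>n. b n)"
    unfolding F_def prod.case infsum_cmult_right' infsum_cmult_left' s[OF a] s[OF b] ..
  finally show "(\<Sum>k. a (fst (prod_decode k)) * b (snd (prod_decode k))) = (\<Sum>n. a n) * (\<Sum>n. b n)"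
    by (simp add: F_def case_prod_beta)
qed

text \<open>\<open>hilbert_tensor\<close> is satisfiable for the Hardy space: since \<open>nat \<times> nat\<close> is equinumerous to \<open>nat\<close>,
  the Hardy space itself can serve as its own tensor square.\<close>

lemma hilbert_tensor_exists: "\<exists>t :: hardy \<Rightarrow> hardy \<Rightarrow> hardy. hilbert_tensor t"
proof -
  let ?l = "\<lambda>k. fst (prod_decode k)" and ?r = "\<lambda>k. snd (prod_decode k)"
  have ss: "summable (\<lambda>k. (norm (hcoeff f (?l k) * hcoeff g (?r k)))\<^sup>2)" for f g
    using prod_decode_summable[of "\<lambda>n. (norm (hcoeff f n))\<^sup>2" "\<lambda>n. (norm (hcoeff g n))\<^sup>2"]
    by (simp add: hcoeff_summable norm_mult power_mult_distrib)
  define t where "t f g = (SOME h. hcoeff h = (\<lambda>k. hcoeff f (?l k) * hcoeff g (?r k)))" for f g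
  have "hcoeff (t f g) = (\<lambda>k. hcoeff f (?l k) * hcoeff g (?r k))" for f g
    unfolding t_def by (rule someI_ex, rule hardy_exists, rule ss)
  then have t: "hcoeff (t f g) k = hcoeff f (?l k) * hcoeff g (?r k)" for f g k by simp
  have inner: "cinner (t u v) (t u' v') = cinner u u' * cinner v v'" for u v u' v'
  proof -
    have n: "summable (\<lambda>n. norm (hcoeff f n * cnj (hcoeff g n)))" for f g
      by (rule sq_summable_mult) (simp_all add: hcoeff_summable)
    have "cinner (t u v) (t u' v') = (\<Sum>k. (hcoeff u (?l k) * cnj (hcoeff u' (?l k))) *
        (hcoeff v (?r k) * cnj (hcoeff v' (?r k))))"
      unfolding cinner_hardy_def t by (simp add: mult_ac)
    also have "\<dots> = cinner u u' * cinner v v'"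
      unfolding cinner_hardy_def by (rule prod_decode_suminf[OF n n])
    finally show ?thesis .
  qed
  define e where "e n = (SOME h. hcoeff h = (\<lambda>m. if m = n then 1 else 0))" for n
  have "hcoeff (e n) = (\<lambda>m. if m = n then 1 else 0)" for n
    unfolding e_def by (rule someI_ex, rule hardy_exists, rule summable_finite[of "{n}"]) auto
  then have e: "hcoeff (e n) m = (if m = n then 1 else 0)" for n m by simp
  have te: "t (e (?l k)) (e (?r k)) = e k" for k
  proof (rule hardy_eqI)
    fix n
    have "?l n = ?l k \<and> ?r n = ?r k \<longleftrightarrow> n = k"
      by (metis prod_eq_iff prod_decode_inverse)
    then show "hcoeff (t (e (?l k)) (e (?r k))) n = hcoeff (e k) n"
      by (auto simp: t e)
  qed
  let ?S = "cspan {t u v | u v. True}"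
  have "f \<in> closure ?S" for f
  proof -
    define p where "p N = (\<Sum>k<N. hcoeff f k *\<^sub>C e k)" for N
    have "e k \<in> ?S" for k
      by (rule complex_vector.span_base) (use te[of k] in \<open>auto intro: sym\<close>)
    then have pS: "p N \<in> ?S" for N
      unfolding p_def by (intro complex_vector.span_sum complex_vector.span_scale)
    have cp: "hcoeff (p N) m = (if m < N then hcoeff f m else 0)" for N m
      unfolding p_def by (induction N) (auto simp: e less_Suc_eq)
    have np: "(norm (f - p N))\<^sup>2 = (\<Sum>n. (norm (hcoeff f (n + N)))\<^sup>2)" for N
    proof -
      have "(norm (f - p N))\<^sup>2 = (\<Sum>n. (norm (hcoeff (f - p N) (n + N)))\<^sup>2)
          + (\<Sum>n<N. (norm (hcoeff (f - p N) n))\<^sup>2)"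
        unfolding norm_hardy_sq by (rule suminf_split_initial_segment[OF hcoeff_summable])
      then show ?thesis by (simp add: cp)
    qed
    have "(\<lambda>N. \<Sum>n. (norm (hcoeff f (n + N)))\<^sup>2) \<longlonglongrightarrow> 0"
      by (rule suminf_exist_split2[OF hcoeff_summable])
    then have "(\<lambda>N. norm (f - p N)) \<longlonglongrightarrow> 0"
      unfolding np[symmetric] using tendsto_real_sqrt by fastforce
    then have "p \<longlonglongrightarrow> f"
      by (subst (asm) norm_minus_commute) (rule LIM_zero_cancel, rule tendsto_norm_zero_cancel)
    then show ?thesis using pS by (auto simp: closure_sequential)
  qed
  then have "closure ?S = UNIV" by auto
  moreover have "t (u + u') v = t u v + t u' v" "t u (v + v') = t u v + t u v'"
    "t (c *\<^sub>C u) v = c *\<^sub>C t u v" "t u (c *\<^sub>C v) = c *\<^sub>C t u v" for c u u' v v'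
    by (rule hardy_eqI, simp add: t algebra_simps)+
  ultimately have "hilbert_tensor t" unfolding hilbert_tensor_def by (simp add: inner)
  then show ?thesis by blast
qed

end

theory Submission
  imports Defs
begin

text \<open>With \<open>E (m, n) = z\<^sup>m \<otimes> z\<^sup>n\<close>, the mean \<open>T\<close> of \<open>S \<otimes> S\<^sup>*\<close> and \<open>S\<^sup>* \<otimes> S\<close> preserves the degree
  \<open>N = m + n\<close>, and on the block of degree \<open>N\<close> it is half the adjacency matrix of a path on \<open>N + 1\<close>
  vertices. Its eigenvalues are \<open>cos (j \<pi> / (N + 2))\<close> for \<open>1 \<le> j \<le> N + 1\<close>, with eigenvector
  \<open>m \<mapsto> sin ((m + 1) j \<pi> / (N + 2))\<close>, which is symmetric for odd \<open>j\<close> and antisymmetric for even \<open>j\<close>.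
  Since \<open>(N + 2, j)\<close> may be multiplied by any odd number, every eigenvalue has infinite multiplicity,
  and so has every element of the two multisets. The eigenvalues are dense in \<open>[-1, 1]\<close>, which
  contains the spectrum because \<open>T\<close> is a selfadjoint contraction.\<close>

text \<open>The tensor product is given only by its defining properties, and the flip and the
  products are \<open>THE\<close> descriptions, so nothing can be computed before existence and
  uniqueness of these operators are established; afterwards everything is read off the coefficients
  \<open>cinner x (E (m, n))\<close>. Infinite multiplicity is what makes the equality of multisets
  cheap: both sides take only the values 0 and \<infinity>, so for each number it remains to decide
  whether some pair \<open>(N, j)\<close> of the right parity produces it. The delicate direction is
  that an eigenvector with the given flip symmetry forces such a pair; it comes from solving a
  three-term recurrence along one line \<open>m + n = N\<close> and comparing the two ends of that
  line. Resolvents are obtained from a contraction argument around a well-chosen scalar, and the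
  interval is filled by limits of eigenvalues.\<close>

instance complex_hilbert \<subseteq> banach ..

section \<open>Complex inner product spaces\<close>

lemma cinner_add_right: "cinner x (y + z) = cinner x y + cinner x z"
  for x y z :: "'a::complex_inner"
  unfolding cinner_commute[of x] by (simp add: cinner_add_left)

lemma cinner_scaleC_right: "cinner x (c *\<^sub>C y) = cnj c * cinner x y"
  for x y :: "'a::complex_inner"
  unfolding cinner_commute[of x] by (simp add: cinner_scaleC_left)

lemma cinner_zero_left [simp]: "cinner 0 y = 0" for y :: "'a::complex_inner"
  using cinner_add_left[of 0 0 y] by simp

lemma cinner_zero_right [simp]: "cinner y 0 = 0" for y :: "'a::complex_inner"
  using cinner_add_right[of y 0 0] by simp

lemma cinner_minus_left: "cinner (- x) y = - cinner x y" for x y :: "'a::complex_inner"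
  using cinner_add_left[of x "- x" y] by (simp add: eq_neg_iff_add_eq_0 add.commute)

lemma cinner_minus_right: "cinner x (- y) = - cinner x y" for x y :: "'a::complex_inner"
  using cinner_add_right[of x y "- y"] by (simp add: eq_neg_iff_add_eq_0 add.commute)

lemma cinner_diff_left: "cinner (x - y) z = cinner x z - cinner y z" for x y z :: "'a::complex_inner"
  using cinner_add_left[of x "- y" z] by (simp add: cinner_minus_left)

lemma cinner_diff_right: "cinner z (x - y) = cinner z x - cinner z y" for x y z :: "'a::complex_inner"
  using cinner_add_right[of z x "- y"] by (simp add: cinner_minus_right)

lemma cinner_sum_left: "cinner (\<Sum>i\<in>A. f i) y = (\<Sum>i\<in>A. cinner (f i) y)"
  for y :: "'a::complex_inner"
  by (induction A rule: infinite_finite_induct) (simp_all add: cinner_add_left)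

lemma cinner_sum_right: "cinner y (\<Sum>i\<in>A. f i) = (\<Sum>i\<in>A. cinner y (f i))"
  for y :: "'a::complex_inner"
  by (induction A rule: infinite_finite_induct) (simp_all add: cinner_add_right)

lemmas cinner_simps = cinner_add_left cinner_add_right cinner_diff_left cinner_diff_right
  cinner_scaleC_left cinner_scaleC_right cinner_minus_left cinner_minus_right
  cinner_sum_left cinner_sum_right

lemma cinner_self: "cinner x x = complex_of_real ((norm x)\<^sup>2)" for x :: "'a::complex_inner"
proof (rule complex_eqI)
  have "Im (cinner x x) = Im (cnj (cinner x x))" by (subst cinner_commute) (rule refl)
  then show "Im (cinner x x) = Im (complex_of_real ((norm x)\<^sup>2))" by simp
qed (simp add: power2_norm_eq_inner inner_Re_cinner)

lemma norm_scaleC [simp]: "norm (c *\<^sub>C x) = cmod c * norm x" for x :: "'a::complex_inner"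
proof -
  have "complex_of_real ((norm (c *\<^sub>C x))\<^sup>2) = complex_of_real ((cmod c * norm x)\<^sup>2)"
    unfolding cinner_self[symmetric] cinner_scaleC_left cinner_scaleC_right
    unfolding mult.assoc[symmetric] cinner_self complex_norm_square[symmetric] power_mult_distrib
    by (simp only: of_real_mult complex_norm_square mult.commute)
  then have "(norm (c *\<^sub>C x))\<^sup>2 = (cmod c * norm x)\<^sup>2" by (simp only: of_real_eq_iff)
  then show ?thesis by (rule power2_eq_imp_eq) simp_all
qed

text \<open>The real inner product determines the complex one, so \<open>cinner\<close> inherits
  bounded linearity, and with it continuity, from \<open>inner\<close>.\<close>

lemma cinner_eq_Complex: "cinner y x = Complex (inner y x) (inner y (\<i> *\<^sub>C x))"
  for x y :: "'a::complex_inner"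
  by (rule complex_eqI) (simp_all add: inner_Re_cinner cinner_simps)

lemma bounded_linear_cinner_left: "bounded_linear (\<lambda>y. cinner y x)" for x :: "'a::complex_inner"
  unfolding cinner_eq_Complex Complex_eq
  by (intro bounded_linear_add bounded_linear_of_real[THEN bounded_linear_compose]
      bounded_linear_mult_right[THEN bounded_linear_compose] bounded_linear_inner_left)

lemma bounded_linear_cinner_right: "bounded_linear (\<lambda>y. cinner x y)" for x :: "'a::complex_inner"
  unfolding cinner_commute[of x]
  by (intro bounded_linear_cnj[THEN bounded_linear_compose] bounded_linear_cinner_left)

lemmas continuous_on_cinner_left = bounded_linear.continuous_on[OF bounded_linear_cinner_left]
lemmas continuous_on_cinner_right = bounded_linear.continuous_on[OF bounded_linear_cinner_right]

lemma bounded_op_on_bounded_linear: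
  assumes "bounded_op_on UNIV F"
  shows "bounded_linear F"
proof -
  obtain C where "\<And>x. norm (F x) \<le> C * norm x"
    using assms by (auto simp: bounded_op_on_def)
  with assms show ?thesis
    by (intro bounded_linear_intro[where K = C])
      (auto simp: bounded_op_on_def scaleR_scaleC mult.commute)
qed

lemma bounded_op_on_diff:
  assumes "bounded_op_on M T" "complex_vector.subspace M" "x \<in> M" "y \<in> M"
  shows "T (x - y) = T x - T y"
proof -
  have "(-1) *\<^sub>C y \<in> M" using assms complex_vector.subspace_scale by blast
  moreover have "T ((-1) *\<^sub>C y) = (-1) *\<^sub>C T y"
    using assms(1,4) unfolding bounded_op_on_def by blast
  ultimately have "T (x + (-1) *\<^sub>C y) = T x + (-1) *\<^sub>C T y"
    using assms(1,3) unfolding bounded_op_on_def by metis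
  then show ?thesis by simp
qed

section \<open>Orthonormal families\<close>

locale orthonormal_family =
  fixes E :: "'i \<Rightarrow> 'k::complex_hilbert"
  assumes cinner_E: "cinner (E p) (E q) = (if p = q then 1 else 0)"
begin

lemma norm_sum_E:
  assumes "finite X"
  shows "(norm (\<Sum>p\<in>X. a p *\<^sub>C E p))\<^sup>2 = (\<Sum>p\<in>X. (cmod (a p))\<^sup>2)"
proof -
  have "complex_of_real ((norm (\<Sum>p\<in>X. a p *\<^sub>C E p))\<^sup>2) = (\<Sum>p\<in>X. a p * cnj (a p))"
    unfolding cinner_self[symmetric] using assms
    by (simp add: cinner_simps cinner_E if_distrib[of "(*) _"] sum.delta cong: if_cong)
      (simp only: mult.commute)
  also have "\<dots> = complex_of_real (\<Sum>p\<in>X. (cmod (a p))\<^sup>2)"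
    unfolding of_real_sum complex_norm_square ..
  finally show ?thesis by (simp only: of_real_eq_iff)
qed

lemma bessel:
  assumes "finite X"
  shows "(\<Sum>p\<in>X. (cmod (cinner x (E p)))\<^sup>2) \<le> (norm x)\<^sup>2"
proof -
  \<comment> \<open>The orthogonal projection of \<open>x\<close> on the span of the chosen
    \<open>E p\<close>; Bessel is then Pythagoras for \<open>x - y\<close> and
    \<open>y\<close>.\<close>
  define y where "y = (\<Sum>p\<in>X. cinner x (E p) *\<^sub>C E p)"
  have "cinner (x - y) (E p) = 0" if "p \<in> X" for p
    using that assms by (simp add: y_def cinner_simps cinner_E if_distrib[of "(*) _"] sum.delta cong: if_cong)
  then have "cinner (x - y) y = 0"
    by (simp add: y_def cinner_sum_right cinner_scaleC_right)
  then have "inner (x - y) y = 0" by (simp add: inner_Re_cinner)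
  then have "(norm x)\<^sup>2 = (norm (x - y))\<^sup>2 + (norm y)\<^sup>2"
    by (simp add: power2_norm_eq_inner inner_simps inner_commute)
  then have "(norm y)\<^sup>2 \<le> (norm x)\<^sup>2" by simp
  then show ?thesis unfolding y_def norm_sum_E[OF assms] .
qed

text \<open>For nested finite sets the squared distance of the partial sums is a difference of
  partial sums of the squared moduli, so the net of finite sums is Cauchy and completeness supplies
  a limit.\<close>

lemma riesz_fischer:
  assumes a: "(\<lambda>p. (cmod (a p))\<^sup>2) summable_on UNIV"
  shows "(\<lambda>p. a p *\<^sub>C E p) summable_on UNIV"
proof -
  let ?f = "\<lambda>p. a p *\<^sub>C E p" and ?g = "\<lambda>p. (cmod (a p))\<^sup>2"
  have "cauchy_filter (filtermap (sum ?f) (finite_subsets_at_top UNIV))"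
    unfolding cauchy_filter_metric_filtermap
  proof (intro allI impI)
    fix e :: real assume e: "e > 0"
    \<comment> \<open>Two partial sums beyond \<open>F0\<close> are each within \<open>e / 3\<close>
      of the one over \<open>F0\<close>, hence strictly within \<open>e\<close> of each
      other.\<close>
    obtain F0 where F0: "finite F0" "dist (sum ?g F0) (infsum ?g UNIV) \<le> (e / 3)\<^sup>2"
      using infsum_finite_approximation[OF a, of "(e / 3)\<^sup>2"] e by auto
    have d: "dist (sum ?f F) (sum ?f F0) \<le> e / 3" if F: "finite F" "F0 \<subseteq> F" for F
    proof -
      have "(dist (sum ?f F) (sum ?f F0))\<^sup>2 = (norm (sum ?f (F - F0)))\<^sup>2"
        unfolding dist_norm using F by (simp add: sum_diff)
      also have "\<dots> = sum ?g (F - F0)" by (rule norm_sum_E) (use F in simp)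
      also have "\<dots> = sum ?g F - sum ?g F0" by (rule sum_diff) (use F in auto)
      also have "\<dots> \<le> infsum ?g UNIV - sum ?g F0"
        using finite_sum_le_infsum[OF a F(1)] by simp
      also have "\<dots> \<le> (e / 3)\<^sup>2" using F0(2) by (simp add: dist_real_def)
      finally show ?thesis by (rule power2_le_imp_le) (use e in simp)
    qed
    show "\<exists>P. eventually P (finite_subsets_at_top UNIV) \<and>
        (\<forall>x y. P x \<and> P y \<longrightarrow> dist (sum ?f x) (sum ?f y) < e)"
    proof (intro exI conjI allI impI)
      show "eventually (\<lambda>F. finite F \<and> F0 \<subseteq> F) (finite_subsets_at_top UNIV)"
        unfolding eventually_finite_subsets_at_top using F0(1) by auto
      fix F F' assume "(finite F \<and> F0 \<subseteq> F) \<and> (finite F' \<and> F0 \<subseteq> F')"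
      then show "dist (sum ?f F) (sum ?f F') < e"
        using d[of F] d[of F'] dist_triangle2[of "sum ?f F" "sum ?f F'" "sum ?f F0"] e by auto
    qed
  qed
  moreover have "complete (UNIV :: 'k set)" by (rule complete_UNIV)
  ultimately obtain L where "(sum ?f \<longlongrightarrow> L) (finite_subsets_at_top UNIV)"
    using complete_uniform[where S = "UNIV :: 'k set"] by (force simp: filterlim_def)
  then show ?thesis using summable_on_def has_sum_def by blast
qed

lemma has_sum_coeff:
  assumes "((\<lambda>p. a p *\<^sub>C E p) has_sum s) UNIV"
  shows "cinner s (E p) = a p"
proof -
  have "((\<lambda>q. cinner (a q *\<^sub>C E q) (E p)) has_sum cinner s (E p)) UNIV"
    by (rule has_sum_bounded_linear[OF bounded_linear_cinner_left assms])
  moreover have "((\<lambda>q. cinner (a q *\<^sub>C E q) (E p)) has_sum a p) UNIV"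
    by (rule has_sum_finite_neutralI[of "{p}"]) (auto simp: cinner_simps cinner_E)
  ultimately show ?thesis by (rule infsumI[symmetric, THEN trans, OF _ infsumI])
qed

lemma has_sum_norm_le:
  assumes "((\<lambda>p. a p *\<^sub>C E p) has_sum s) UNIV"
    and "\<And>X. finite X \<Longrightarrow> (\<Sum>p\<in>X. (cmod (a p))\<^sup>2) \<le> B\<^sup>2" "B \<ge> 0"
  shows "norm s \<le> B"
proof (rule tendsto_upperbound)
  show "((\<lambda>X. norm (\<Sum>p\<in>X. a p *\<^sub>C E p)) \<longlongrightarrow> norm s) (finite_subsets_at_top UNIV)"
    using assms(1) unfolding has_sum_def by (rule tendsto_norm)
  have "norm (\<Sum>p\<in>X. a p *\<^sub>C E p) \<le> B" if "finite X" for X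
    by (rule power2_le_imp_le) (use assms(2,3) that in \<open>auto simp: norm_sum_E\<close>)
  then show "\<forall>\<^sub>F X in finite_subsets_at_top UNIV. norm (\<Sum>p\<in>X. a p *\<^sub>C E p) \<le> B"
    by (auto intro: eventually_finite_subsets_at_top_weakI)
qed simp

lemma has_sum_in_closed:
  assumes "closed V" "complex_vector.subspace V" "\<And>p. E p \<in> V"
    and "((\<lambda>p. a p *\<^sub>C E p) has_sum s) UNIV"
  shows "s \<in> V"
proof (rule Lim_in_closed_set)
  show "((\<lambda>X. \<Sum>p\<in>X. a p *\<^sub>C E p) \<longlongrightarrow> s) (finite_subsets_at_top UNIV)"
    using assms(4) unfolding has_sum_def .
  have "(\<Sum>p\<in>X. a p *\<^sub>C E p) \<in> V" for X
    using assms by (intro complex_vector.subspace_sum complex_vector.subspace_scale)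
  then show "\<forall>\<^sub>F X in finite_subsets_at_top UNIV. (\<Sum>p\<in>X. a p *\<^sub>C E p) \<in> V" by simp
qed (use assms in auto)

end

text \<open>Density is phrased through closed subspaces because each use of it verifies a closed
  linear condition on the \<open>E p\<close>.\<close>

locale orthonormal_basis = orthonormal_family +
  assumes dense_E: "closed V \<Longrightarrow> complex_vector.subspace V \<Longrightarrow> (\<And>p. E p \<in> V) \<Longrightarrow> V = UNIV"
begin

text \<open>The vectors orthogonal to \<open>x - y\<close> form a closed subspace containing every
  \<open>E p\<close>; so \<open>x - y\<close> is orthogonal to itself.\<close>

lemma eq_coeffI:
  assumes "\<And>p. cinner x (E p) = cinner y (E p)"
  shows "x = y"
proof -
  let ?V = "{z. cinner (x - y) z = 0}"
  have "?V = UNIV"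
  proof (rule dense_E)
    show "closed ?V"
      by (intro closed_Collect_eq continuous_on_cinner_right continuous_intros)
    show "complex_vector.subspace ?V"
      by (rule complex_vector.subspaceI) (auto simp: cinner_simps)
  qed (use assms in \<open>auto simp: cinner_simps\<close>)
  then have "cinner (x - y) (x - y) = 0" by auto
  then show ?thesis by (simp add: cinner_self)
qed

text \<open>The source of existence for the flip and both products. Injectivity makes every
  coefficient of \<open>x\<close> occur at most once, so Bessel bounds the new coefficients by
  \<open>norm x\<close>; Riesz-Fischer turns them into a vector, and the same bound gives the
  contraction.\<close>

lemma coeff_reindex_op:
  assumes inj: "inj_on \<tau> D"
  shows "\<exists>F. bounded_op_on UNIV F \<and> (\<forall>x. norm (F x) \<le> norm x) \<and>
    (\<forall>x p. cinner (F x) (E p) = (if p \<in> D then cinner x (E (\<tau> p)) else 0))"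
proof -
  define a where "a x p = (if p \<in> D then cinner x (E (\<tau> p)) else 0)" for x p
  have B: "(\<Sum>p\<in>X. (cmod (a x p))\<^sup>2) \<le> (norm x)\<^sup>2" if "finite X" for X x
  proof -
    have "(\<Sum>p\<in>X. (cmod (a x p))\<^sup>2) = (\<Sum>p\<in>X \<inter> D. (cmod (cinner x (E (\<tau> p))))\<^sup>2)"
      unfolding a_def using that by (intro sum.mono_neutral_cong_right) auto
    also have "\<dots> = (\<Sum>p\<in>\<tau> ` (X \<inter> D). (cmod (cinner x (E p)))\<^sup>2)"
      by (subst sum.reindex) (use inj in \<open>auto intro: inj_on_subset\<close>)
    also have "\<dots> \<le> (norm x)\<^sup>2" using that by (intro bessel) auto
    finally show ?thesis .
  qed
  have "(\<lambda>p. (cmod (a x p))\<^sup>2) summable_on UNIV" for x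
    by (rule nonneg_bdd_above_summable_on) (auto intro!: bdd_aboveI2 B)
  then have "\<exists>s. ((\<lambda>p. a x p *\<^sub>C E p) has_sum s) UNIV" for x
    using riesz_fischer unfolding summable_on_def by blast
  then obtain F where F: "\<And>x. ((\<lambda>p. a x p *\<^sub>C E p) has_sum F x) UNIV" by metis
  have c: "cinner (F x) (E p) = a x p" for x p by (rule has_sum_coeff[OF F])
  have n: "norm (F x) \<le> norm x" for x by (rule has_sum_norm_le[OF F B]) auto
  have "F (x + y) = F x + F y" for x y
    by (rule eq_coeffI) (simp add: cinner_add_left c, simp add: a_def cinner_add_left)
  moreover have "F (d *\<^sub>C x) = d *\<^sub>C F x" for d x
    by (rule eq_coeffI) (simp add: cinner_scaleC_left c, simp add: a_def cinner_scaleC_left)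
  ultimately have "bounded_op_on UNIV F"
    unfolding bounded_op_on_def using n by (auto intro!: exI[of _ 1])
  with n c show ?thesis unfolding a_def by blast
qed

end

section \<open>Selfadjoint contractions on a closed subspace\<close>

locale closed_subspace =
  fixes M :: "'k::complex_hilbert set"
  assumes closed_M: "closed M" and subspace_M: "complex_vector.subspace M"
begin

lemmas M_add = complex_vector.subspace_add[OF subspace_M]
lemmas M_diff = complex_vector.subspace_diff[OF subspace_M]
lemmas M_scale = complex_vector.subspace_scale[OF subspace_M]
lemmas M_zero = complex_vector.subspace_0[OF subspace_M]

text \<open>For each \<open>y\<close> in \<open>M\<close> the map \<open>x \<mapsto> G x + y\<close>
  is a contraction of the complete set \<open>M\<close>; its fixed point solves
  \<open>x - G x = y\<close>. Uniqueness of fixed points makes the solution operator linear.\<close>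

lemma neumann:
  assumes G: "bounded_op_on M G" and q: "0 \<le> q" "q < 1"
    and le: "\<And>x. x \<in> M \<Longrightarrow> norm (G x) \<le> q * norm x"
  shows "\<exists>R. bounded_op_on M R \<and> (\<forall>x\<in>M. R (x - G x) = x \<and> R x - G (R x) = x)"
proof -
  have ex: "\<exists>!x\<in>M. G x + y = x" if y: "y \<in> M" for y
  proof (rule Banach_fix)
    show "complete M" using closed_M by (simp add: complete_eq_closed)
    show "M \<noteq> {}" using y by auto
    show "(\<lambda>x. G x + y) ` M \<subseteq> M"
      using G y M_add unfolding bounded_op_on_def by auto
    fix u v assume "u \<in> M" "v \<in> M"
    then show "dist (G u + y) (G v + y) \<le> q * dist u v"
      using le[of "u - v"] M_diff by (simp add: dist_norm bounded_op_on_diff[OF G subspace_M])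
  qed (use q in auto)
  define R where "R y = (THE x. x \<in> M \<and> G x + y = x)" for y
  have R: "R y \<in> M" "G (R y) + y = R y" if "y \<in> M" for y
    using theI'[OF ex[OF that]] unfolding R_def by auto
  have R_eq: "R y = x" if "y \<in> M" "x \<in> M" "G x + y = x" for x y
    unfolding R_def using ex[OF that(1)] that by (intro the1_equality) auto
  have Gadd: "G (x + y) = G x + G y" and Gsc: "G (c *\<^sub>C x) = c *\<^sub>C G x"
    and GM: "G x \<in> M" if "x \<in> M" "y \<in> M" for x y c
    using G that unfolding bounded_op_on_def by auto
  have "R (x + y) = R x + R y" if xy: "x \<in> M" "y \<in> M" for x y
  proof (rule R_eq)
    have "G (R x + R y) + (x + y) = (G (R x) + x) + (G (R y) + y)"
      using R(1) xy by (simp add: Gadd)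
    then show "G (R x + R y) + (x + y) = R x + R y" using R(2) xy by simp
  qed (use xy R(1) M_add in auto)
  moreover have "R (c *\<^sub>C x) = c *\<^sub>C R x" if x: "x \<in> M" for c x
  proof (rule R_eq)
    have "G (c *\<^sub>C R x) + c *\<^sub>C x = c *\<^sub>C (G (R x) + x)"
      using R(1)[OF x] x by (simp add: Gsc scaleC_add_right)
    then show "G (c *\<^sub>C R x) + c *\<^sub>C x = c *\<^sub>C R x" using R(2) x by simp
  qed (use x R(1) M_scale in auto)
  moreover have "norm (R x) \<le> (1 / (1 - q)) * norm x" if x: "x \<in> M" for x
  proof -
    have "norm (R x) = norm (G (R x) + x)" using R(2) x by simp
    also have "\<dots> \<le> norm (G (R x)) + norm x" by (rule norm_triangle_ineq)
    also have "\<dots> \<le> q * norm (R x) + norm x" using le R(1) x by simp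
    finally have "(1 - q) * norm (R x) \<le> norm x" by (simp add: algebra_simps)
    then show ?thesis using q by (simp add: field_simps)
  qed
  ultimately have "bounded_op_on M R" unfolding bounded_op_on_def using R(1) by blast
  moreover have "R (x - G x) = x \<and> R x - G (R x) = x" if "x \<in> M" for x
    using R_eq[of "x - G x" x] R(2)[of x] that GM M_diff by (auto simp: algebra_simps)
  ultimately show ?thesis by blast
qed

end

locale selfadjoint_contraction = closed_subspace +
  fixes A
  assumes selfadjoint: "selfadjoint_on M A"
    and contraction: "x \<in> M \<Longrightarrow> norm (A x) \<le> norm x"
begin

lemma bounded_op: "bounded_op_on M A"
  using selfadjoint unfolding selfadjoint_on_def is_adjoint_on_def by blast

lemma cinner_A: "x \<in> M \<Longrightarrow> y \<in> M \<Longrightarrow> cinner (A x) y = cinner x (A y)"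
  using selfadjoint unfolding selfadjoint_on_def is_adjoint_on_def by blast

lemma
  shows A_in: "x \<in> M \<Longrightarrow> A x \<in> M"
    and A_add: "x \<in> M \<Longrightarrow> y \<in> M \<Longrightarrow> A (x + y) = A x + A y"
    and A_scale: "x \<in> M \<Longrightarrow> A (c *\<^sub>C x) = c *\<^sub>C A x"
  using bounded_op unfolding bounded_op_on_def by auto

text \<open>The hypothesis says that \<open>A - \<mu>\<close> lies within \<open>q * cmod c\<close>
  of the scalar \<open>- c\<close>, so \<open>A - \<mu> = - c (I - G)\<close> with \<open>G\<close>
  of norm at most \<open>q\<close>, and \<open>neumann\<close> inverts it. The free choice of
  \<open>c\<close> serves both the exterior of the disk and the nonreal points.\<close>

lemma not_in_spectrum:
  assumes c: "c \<noteq> 0" and q: "0 \<le> q" "q < 1"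
    and le: "\<And>x. x \<in> M \<Longrightarrow> norm (A x + (c - \<mu>) *\<^sub>C x) \<le> q * cmod c * norm x"
  shows "\<mu> \<notin> spectrum_on M A"
proof -
  define G where "G x = (1 / c) *\<^sub>C (A x + (c - \<mu>) *\<^sub>C x)" for x
  have nG: "norm (G x) \<le> q * norm x" if "x \<in> M" for x
  proof -
    have "norm (G x) * cmod c = norm (A x + (c - \<mu>) *\<^sub>C x)"
      unfolding G_def norm_scaleC using c by (simp only: norm_divide) simp
    also have "\<dots> \<le> (q * norm x) * cmod c" using le[OF that] by (simp only: mult_ac)
    finally show ?thesis using c by simp
  qed
  have G: "bounded_op_on M G"
    unfolding bounded_op_on_def
  proof (intro conjI ballI allI)
    fix x y c' assume x: "x \<in> M"
    show "G x \<in> M" unfolding G_def using x by (intro M_add M_scale A_in)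
    show "G (c' *\<^sub>C x) = c' *\<^sub>C G x"
      using x by (simp add: G_def A_scale scaleC_add_right scaleC_scaleC mult_ac)
    assume y: "y \<in> M"
    show "G (x + y) = G x + G y"
      using x y by (simp add: G_def A_add scaleC_add_right)
  qed (use nG in blast)
  have IG: "x - G x = (- 1 / c) *\<^sub>C (A x - \<mu> *\<^sub>C x)" for x
    using c by (simp add: G_def scaleC_add_right complex_vector.scale_right_diff_distrib
        complex_vector.scale_left_diff_distrib scaleC_scaleC diff_divide_distrib scaleC_one
        right_diff_distrib)
  obtain R where R: "bounded_op_on M R" "\<And>x. x \<in> M \<Longrightarrow> R (x - G x) = x"
    "\<And>x. x \<in> M \<Longrightarrow> R x - G (R x) = x"
    using neumann[OF G q nG] by blast
  define S where "S y = R ((- 1 / c) *\<^sub>C y)" for y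
  have RM: "R y \<in> M" if "y \<in> M" for y using R(1) that unfolding bounded_op_on_def by blast
  have S_eq: "S y = (- 1 / c) *\<^sub>C R y" if "y \<in> M" for y
    using R(1) that unfolding bounded_op_on_def S_def by blast
  obtain C where C: "\<And>x. x \<in> M \<Longrightarrow> norm (R x) \<le> C * norm x"
    using R(1) unfolding bounded_op_on_def by blast
  have "bounded_op_on M S"
    unfolding bounded_op_on_def
  proof (intro conjI ballI allI exI)
    fix x y c' assume x: "x \<in> M"
    show "S x \<in> M" unfolding S_def using x by (intro RM M_scale)
    show "S (c' *\<^sub>C x) = c' *\<^sub>C S x"
      using x R(1) by (simp add: S_eq M_scale bounded_op_on_def scaleC_scaleC mult_ac)
    show "norm (S x) \<le> (C / cmod c) * norm x"
      using C[OF x] c x by (simp add: S_eq norm_divide divide_right_mono)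
    assume y: "y \<in> M"
    show "S (x + y) = S x + S y"
      using x y R(1) by (simp add: S_eq M_add bounded_op_on_def scaleC_add_right)
  qed
  moreover have "S (A x - \<mu> *\<^sub>C x) = x" if "x \<in> M" for x
    using R(2)[OF that] by (simp add: S_def IG)
  moreover have "A (S x) - \<mu> *\<^sub>C S x = x" if "x \<in> M" for x
  proof -
    have "(- 1 / c) *\<^sub>C x \<in> M" using that M_scale by blast
    then have "S x - G (S x) = (- 1 / c) *\<^sub>C x" unfolding S_def by (rule R(3))
    then have "(- c) *\<^sub>C ((- 1 / c) *\<^sub>C (A (S x) - \<mu> *\<^sub>C S x)) = (- c) *\<^sub>C ((- 1 / c) *\<^sub>C x)"
      by (simp only: IG)
    then show ?thesis unfolding scaleC_scaleC using c by (simp add: scaleC_one)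
  qed
  ultimately show ?thesis unfolding spectrum_on_def by blast
qed

lemma spectrum_real: "spectrum_on M A \<subseteq> complex_of_real ` {-1..1}"
proof
  fix \<mu> assume \<mu>: "\<mu> \<in> spectrum_on M A"
  have "cmod \<mu> \<le> 1"
  proof (rule ccontr)
    assume "\<not> cmod \<mu> \<le> 1"
    \<comment> \<open>With \<open>c = \<mu>\<close> the scalar term cancels and the contraction
      bound gives the ratio \<open>1 / cmod \<mu>\<close>.\<close>
    then have "\<mu> \<notin> spectrum_on M A"
      by (intro not_in_spectrum[of \<mu> "1 / cmod \<mu>"]) (auto simp: contraction divide_less_eq_1)
    with \<mu> show False by contradiction
  qed
  moreover have "Im \<mu> = 0"
  proof (rule ccontr)
    define a b where "a = Re \<mu>" and "b = Im \<mu>"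
    assume "Im \<mu> \<noteq> 0"
    then have b: "b \<noteq> 0" by (simp add: b_def)
    \<comment> \<open>For \<open>c = \<i> * s\<close> the estimate below compares
      \<open>(1 + \<bar>a\<bar>)\<^sup>2 + (s - b)\<^sup>2\<close> with \<open>s\<^sup>2\<close>;
      the difference is \<open>K - 2 * s * b\<close>, and \<open>s = K / b\<close> makes it
      \<open>- K\<close>.\<close>
    define K where "K = (1 + \<bar>a\<bar>)\<^sup>2 + b\<^sup>2"
    define s where "s = K / b"
    have K: "K > 0" unfolding K_def using b by (intro add_nonneg_pos) auto
    then have s: "s \<noteq> 0" using b by (simp add: s_def)
    have sK: "(1 + \<bar>a\<bar>)\<^sup>2 + (s - b)\<^sup>2 = s\<^sup>2 - K"
      using b by (simp add: s_def K_def power2_diff)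
    have sK0: "0 \<le> s\<^sup>2 - K" unfolding sK[symmetric] by simp
    have "\<mu> \<notin> spectrum_on M A"
    proof (rule not_in_spectrum)
      show "\<i> * complex_of_real s \<noteq> 0" using s by simp
      show "0 \<le> sqrt (s\<^sup>2 - K) / \<bar>s\<bar>" using sK0 by simp
      have "sqrt (s\<^sup>2 - K) < sqrt (s\<^sup>2)" using K by (intro real_sqrt_less_mono) simp
      then show "sqrt (s\<^sup>2 - K) / \<bar>s\<bar> < 1" using s by simp
      fix x assume x: "x \<in> M"
      \<comment> \<open>\<open>cinner u x\<close> is real by selfadjointness, so for the real inner
        product \<open>u\<close> is orthogonal to every imaginary multiple of \<open>x\<close>, and
        Pythagoras applies.\<close>
      define u where "u = A x - complex_of_real a *\<^sub>C x"
      have "cnj (cinner u x) = cinner u x"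
        using cinner_A[OF x x] by (simp add: u_def cinner_simps cinner_commute[of x] cinner_self)
      then have im: "Im (cinner u x) = 0" by (simp add: complex_eq_iff)
      have eq: "A x + (\<i> * complex_of_real s - \<mu>) *\<^sub>C x = u + (\<i> * complex_of_real (s - b)) *\<^sub>C x"
      proof -
        have "\<i> * complex_of_real s - \<mu> = - complex_of_real a + \<i> * complex_of_real (s - b)"
          by (simp add: a_def b_def complex_eq_iff)
        then show ?thesis
          by (simp only: scaleC_add_left u_def) simp
      qed
      have "norm u \<le> norm (A x) + norm (complex_of_real a *\<^sub>C x)"
        unfolding u_def by (rule norm_triangle_ineq4)
      also have "\<dots> \<le> (1 + \<bar>a\<bar>) * norm x"
        using contraction[OF x] by (simp add: algebra_simps)
      finally have nu: "norm u \<le> (1 + \<bar>a\<bar>) * norm x" .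
      have "(norm (u + (\<i> * complex_of_real (s - b)) *\<^sub>C x))\<^sup>2 = (norm u)\<^sup>2 + (s - b)\<^sup>2 * (norm x)\<^sup>2"
      proof -
        have "inner u ((\<i> * complex_of_real (s - b)) *\<^sub>C x) = 0"
          using im by (simp add: inner_Re_cinner cinner_simps del: of_real_diff)
        moreover have "(norm (u + w))\<^sup>2 = (norm u)\<^sup>2 + (norm w)\<^sup>2" if "inner u w = 0" for w
          using that by (simp add: power2_norm_eq_inner inner_add_left inner_add_right inner_commute)
        ultimately have "(norm (u + (\<i> * complex_of_real (s - b)) *\<^sub>C x))\<^sup>2
            = (norm u)\<^sup>2 + (norm ((\<i> * complex_of_real (s - b)) *\<^sub>C x))\<^sup>2" by blast
        then show ?thesis by (simp add: norm_mult power_mult_distrib del: of_real_diff)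
      qed
      also have "\<dots> \<le> ((1 + \<bar>a\<bar>) * norm x)\<^sup>2 + (s - b)\<^sup>2 * (norm x)\<^sup>2"
        using nu by (intro add_right_mono power_mono) auto
      also have "\<dots> = (s\<^sup>2 - K) * (norm x)\<^sup>2"
        unfolding sK[symmetric] power_mult_distrib by (rule distrib_right[symmetric])
      also have "\<dots> = (sqrt (s\<^sup>2 - K) * norm x)\<^sup>2"
        using sK0 by (simp add: power_mult_distrib)
      finally have "norm (u + (\<i> * complex_of_real (s - b)) *\<^sub>C x) \<le> sqrt (s\<^sup>2 - K) * norm x"
        by (rule power2_le_imp_le) (use sK0 in simp)
      then show "norm (A x + (\<i> * complex_of_real s - \<mu>) *\<^sub>C x)
          \<le> sqrt (s\<^sup>2 - K) / \<bar>s\<bar> * cmod (\<i> * complex_of_real s) * norm x"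
        unfolding eq using s by (simp add: norm_mult)
    qed
    with \<mu> show False by contradiction
  qed
  ultimately show "\<mu> \<in> complex_of_real ` {-1..1}"
    by (intro image_eqI[of _ _ "Re \<mu>"]) (auto simp: complex_eq_iff cmod_def)
qed

text \<open>A bounded inverse would give
  \<open>1 \<le> C * norm (A (x n) - \<mu> *\<^sub>C x n)\<close>, whose right side tends to
  0.\<close>

lemma approx_point_spectrum_subset: "approx_point_spectrum_on M A \<subseteq> spectrum_on M A"
proof
  fix \<mu> assume "\<mu> \<in> approx_point_spectrum_on M A"
  then obtain x where x: "\<And>n. x n \<in> M" "\<And>n. norm (x n) = 1"
    and lim: "(\<lambda>n. A (x n) - \<mu> *\<^sub>C x n) \<longlonglongrightarrow> 0"
    unfolding approx_point_spectrum_on_def by auto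
  show "\<mu> \<in> spectrum_on M A"
    unfolding spectrum_on_def
  proof (rule CollectI, rule notI, elim exE conjE)
    fix R assume R: "bounded_op_on M R"
      and inv: "\<forall>x\<in>M. R (A x - \<mu> *\<^sub>C x) = x \<and> A (R x) - \<mu> *\<^sub>C R x = x"
    obtain C where C: "\<And>x. x \<in> M \<Longrightarrow> norm (R x) \<le> C * norm x"
      using R unfolding bounded_op_on_def by blast
    have "1 \<le> C * norm (A (x n) - \<mu> *\<^sub>C x n)" for n
    proof -
      have "A (x n) - \<mu> *\<^sub>C x n \<in> M" using x(1) by (intro M_diff A_in M_scale)
      from C[OF this] show ?thesis using inv x by simp
    qed
    moreover have "(\<lambda>n. C * norm (A (x n) - \<mu> *\<^sub>C x n)) \<longlonglongrightarrow> C * norm (0 :: 'a)"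
      by (intro tendsto_intros lim)
    ultimately have "1 \<le> C * norm (0 :: 'a)"
      by (intro LIMSEQ_le_const) auto
    then show False by simp
  qed
qed

lemma approx_eigenvalue:
  assumes x: "\<And>n. x n \<in> M" "\<And>n. x n \<noteq> 0" "\<And>n. A (x n) = \<nu> n *\<^sub>C x n" and \<nu>: "\<nu> \<longlonglongrightarrow> \<mu>"
  shows "\<mu> \<in> approx_point_spectrum_on M A"
  unfolding approx_point_spectrum_on_def
proof (intro CollectI exI conjI allI)
  define y where "y n = complex_of_real (1 / norm (x n)) *\<^sub>C x n" for n :: nat
  fix n
  show "y n \<in> M" unfolding y_def using x(1) by (rule M_scale)
  show "norm (y n) = 1" using x(2) by (simp add: y_def norm_divide)
next
  define y where "y n = complex_of_real (1 / norm (x n)) *\<^sub>C x n" for n :: nat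
  have "A (y n) = \<nu> n *\<^sub>C y n" for n
    unfolding y_def using x(1,3) by (simp add: A_scale scaleC_scaleC mult.commute)
  then have eq: "A (y n) - \<mu> *\<^sub>C y n = (\<nu> n - \<mu>) *\<^sub>C y n" for n
    by (simp add: complex_vector.scale_left_diff_distrib)
  have "norm (y n) = 1" for n using x(2) by (simp add: y_def norm_divide)
  then have n: "norm (A (y n) - \<mu> *\<^sub>C y n) = cmod (\<nu> n - \<mu>)" for n by (simp add: eq)
  have "(\<lambda>n. cmod (\<nu> n - \<mu>)) \<longlonglongrightarrow> 0"
    using \<nu> by (intro tendsto_norm_zero LIM_zero)
  then show "(\<lambda>n. A (y n) - \<mu> *\<^sub>C y n) \<longlonglongrightarrow> 0"
    unfolding n[symmetric] by (rule tendsto_norm_zero_cancel)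
qed

lemma eigenvalue_real:
  assumes "x \<in> M" "x \<noteq> 0" "A x = \<mu> *\<^sub>C x"
  obtains r where "\<mu> = complex_of_real r" "-1 \<le> r" "r \<le> 1"
proof -
  \<comment> \<open>A genuine eigenvalue is the case of a constant sequence; its reality and bound
    then come from the spectrum.\<close>
  have "\<mu> \<in> approx_point_spectrum_on M A"
    by (rule approx_eigenvalue[of "\<lambda>_. x" "\<lambda>_. \<mu>"]) (use assms in auto)
  then show ?thesis
    using approx_point_spectrum_subset spectrum_real that by auto
qed

text \<open>Approximate unit eigenvectors for 1 satisfy
  \<open>norm (A (x n)) \<ge> 1 - norm (A (x n) - x n)\<close>, which pushes the supremum up to 1;
  the contraction bound caps it.\<close>

lemma op_norm_eq_1:
  assumes "1 \<in> approx_point_spectrum_on M A"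
  shows "op_norm_on M A = 1"
proof -
  obtain x where x: "\<And>n. x n \<in> M" "\<And>n. norm (x n) = 1"
    and lim: "(\<lambda>n. A (x n) - 1 *\<^sub>C x n) \<longlonglongrightarrow> 0"
    using assms unfolding approx_point_spectrum_on_def by auto
  let ?X = "{x \<in> M. norm x \<le> 1}"
  have le: "norm (A y) \<le> 1" if "y \<in> ?X" for y
    using contraction[of y] that by auto
  have bdd: "bdd_above ((\<lambda>x. norm (A x)) ` ?X)"
    by (rule bdd_aboveI2[of _ _ 1]) (rule le)
  have ge: "norm (A (x n)) \<le> op_norm_on M A" for n
    unfolding op_norm_on_def using x by (intro cSUP_upper bdd) auto
  have "1 - norm (A (x n) - 1 *\<^sub>C x n) \<le> op_norm_on M A" for n
    using ge[of n] norm_triangle_ineq2[of "x n" "A (x n)"] x(2)[of n]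
    by (simp add: norm_minus_commute)
  moreover have "(\<lambda>n. 1 - norm (A (x n) - 1 *\<^sub>C x n)) \<longlonglongrightarrow> 1 - norm (0 :: 'a)"
    by (intro tendsto_intros lim)
  ultimately have "1 - norm (0 :: 'a) \<le> op_norm_on M A"
    by (intro LIMSEQ_le_const2) auto
  moreover have "op_norm_on M A \<le> 1"
    unfolding op_norm_on_def by (rule cSUP_least) (use le M_zero in auto)
  ultimately show ?thesis by simp
qed

end

section \<open>The tensor square of the Hardy space\<close>

definition hmonom :: "nat \<Rightarrow> hardy" where
  "hmonom n = (SOME f. hcoeff f = (\<lambda>m. if m = n then 1 else 0))"

lemma hcoeff_hmonom [simp]: "hcoeff (hmonom n) m = (if m = n then 1 else 0)"
proof -
  have "hcoeff (hmonom n) = (\<lambda>m. if m = n then 1 else 0)"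
    unfolding hmonom_def by (rule someI_ex, rule hardy_exists, rule summable_finite[of "{n}"]) auto
  then show ?thesis by simp
qed

lemma cinner_hmonom: "cinner f (hmonom n) = hcoeff f n"
  unfolding cinner_hardy_def by (subst suminf_finite[of "{n}"]) auto

text \<open>Riesz-Fischer sums the Taylor expansion of \<open>f\<close> in norm, and the sum has the
  same coefficients as \<open>f\<close>.\<close>

lemma hardy_dense:
  assumes "closed V" "complex_vector.subspace V" "\<And>n. hmonom n \<in> V"
  shows "f \<in> V"
proof -
  interpret orthonormal_family hmonom
    by unfold_locales (auto simp: cinner_hmonom)
  have "(\<lambda>n. (cmod (hcoeff f n))\<^sup>2) summable_on UNIV"
    using hcoeff_summable[of f] by (subst summable_on_UNIV_nonneg_real_iff) auto
  then have "(\<lambda>n. hcoeff f n *\<^sub>C hmonom n) summable_on UNIV" by (rule riesz_fischer)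
  then obtain s where s: "((\<lambda>n. hcoeff f n *\<^sub>C hmonom n) has_sum s) UNIV"
    unfolding summable_on_def by blast
  have "s = f"
    by (rule hardy_eqI) (use has_sum_coeff[OF s] in \<open>simp add: cinner_hmonom\<close>)
  then show ?thesis using has_sum_in_closed[OF assms s] by simp
qed

locale hardy_tensor =
  fixes t :: "hardy \<Rightarrow> hardy \<Rightarrow> 'k::complex_hilbert"
  assumes tensor: "hilbert_tensor t"
begin

lemma
  shows t_add_left: "t (u + u') v = t u v + t u' v"
    and t_add_right: "t u (v + v') = t u v + t u v'"
    and t_scale_left: "t (c *\<^sub>C u) v = c *\<^sub>C t u v"
    and t_scale_right: "t u (c *\<^sub>C v) = c *\<^sub>C t u v"
    and cinner_t: "cinner (t u v) (t u' v') = cinner u u' * cinner v v'"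
    and closure_t: "closure (cspan {t u v | u v. True}) = UNIV"
  using tensor unfolding hilbert_tensor_def by blast+

lemma norm_t: "norm (t u v) = norm u * norm v"
proof -
  have "complex_of_real ((norm (t u v))\<^sup>2) = complex_of_real ((norm u * norm v)\<^sup>2)"
    using cinner_t[of u v u v] by (simp only: cinner_self power_mult_distrib of_real_mult)
  then have "(norm (t u v))\<^sup>2 = (norm u * norm v)\<^sup>2" by (simp only: of_real_eq_iff)
  then show ?thesis by (rule power2_eq_imp_eq) simp_all
qed

lemma bounded_linear_t_left: "bounded_linear (\<lambda>u. t u v)"
  by (rule bounded_linear_intro[where K = "norm v"])
    (auto simp: t_add_left scaleR_scaleC t_scale_left norm_t)

lemma bounded_linear_t_right: "bounded_linear (\<lambda>v. t u v)"
  by (rule bounded_linear_intro[where K = "norm u"])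
    (auto simp: t_add_right scaleR_scaleC t_scale_right norm_t)

lemma t_zero_left [simp]: "t 0 v = 0" and t_zero_right [simp]: "t u 0 = 0"
  using norm_t[of 0 v] norm_t[of u 0] by simp_all

lemma tensor_dense:
  assumes V: "closed V" "complex_vector.subspace V" and t: "\<And>u v. t u v \<in> V"
  shows "V = UNIV"
proof -
  have "cspan {t u v | u v. True} \<subseteq> V"
    using V t by (intro complex_vector.span_minimal) auto
  then have "closure (cspan {t u v | u v. True}) \<subseteq> V"
    using V by (intro closure_minimal)
  then show ?thesis using closure_t by auto
qed

definition E :: "nat \<times> nat \<Rightarrow> 'k" where
  "E p = t (hmonom (fst p)) (hmonom (snd p))"

text \<open>One factor is treated at a time, using separate continuity of \<open>t\<close>: the
  right factor stays a monomial while the left one varies over the Hardy space; then any left factor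
  is fixed while the right one varies.\<close>

lemma E_dense:
  assumes V: "closed V" "complex_vector.subspace V" and E: "\<And>p. E p \<in> V"
  shows "V = UNIV"
proof (rule tensor_dense[OF V])
  have *: "t u (hmonom n) \<in> V" for u n
  proof -
    have "u \<in> {u. t u (hmonom n) \<in> V}"
    proof (rule hardy_dense)
      have "continuous_on UNIV (\<lambda>u. t u (hmonom n))"
        by (rule linear_continuous_on[OF bounded_linear_t_left])
      then show "closed {u. t u (hmonom n) \<in> V}"
        using closed_vimage[OF V(1)] by (simp add: vimage_def)
      show "complex_vector.subspace {u. t u (hmonom n) \<in> V}"
        using V(2) by (intro complex_vector.subspaceI)
          (auto simp: t_add_left t_scale_left complex_vector.subspace_def)
      show "hmonom m \<in> {u. t u (hmonom n) \<in> V}" for m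
        using E[of "(m, n)"] by (simp add: E_def)
    qed
    then show ?thesis by simp
  qed
  show "t u v \<in> V" for u v
  proof -
    have "v \<in> {v. t u v \<in> V}"
    proof (rule hardy_dense)
      have "continuous_on UNIV (\<lambda>v. t u v)"
        by (rule linear_continuous_on[OF bounded_linear_t_right])
      then show "closed {v. t u v \<in> V}"
        using closed_vimage[OF V(1)] by (simp add: vimage_def)
      show "complex_vector.subspace {v. t u v \<in> V}"
        using V(2) by (intro complex_vector.subspaceI)
          (auto simp: t_add_right t_scale_right complex_vector.subspace_def)
    qed (use * in auto)
    then show ?thesis by simp
  qed
qed

sublocale orthonormal_basis E
  by unfold_locales (auto simp: E_def cinner_t cinner_hmonom E_dense prod_eq_iff)

lemma cinner_t_E: "cinner (t u v) (E p) = hcoeff u (fst p) * hcoeff v (snd p)"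
  by (simp add: E_def cinner_t cinner_hmonom)

section \<open>Uniqueness and existence of the flip and of the tensor operators\<close>

lemma bounded_op_eqI:
  assumes F: "bounded_op_on UNIV F" and G: "bounded_op_on UNIV G"
    and eq: "\<And>u v. F (t u v) = G (t u v)"
  shows "F = G"
proof -
  have "{x. F x = G x} = UNIV"
  proof (rule tensor_dense)
    show "closed {x. F x = G x}"
      using F G by (intro closed_Collect_eq linear_continuous_on bounded_op_on_bounded_linear)
    show "complex_vector.subspace {x. F x = G x}"
    proof (rule complex_vector.subspaceI)
      show "0 \<in> {x. F x = G x}" using eq[of 0 0] by simp
    qed (use F G in \<open>auto simp: bounded_op_on_def\<close>)
  qed (use eq in simp)
  then show ?thesis by auto
qed

lemma tensor_op_eqI:
  assumes "bounded_op_on UNIV F" "\<And>u v. F (t u v) = t (A u) (B v)"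
  shows "tensor_op t A B = F"
  unfolding tensor_op_def
  by (rule the_equality) (use assms in \<open>auto intro!: bounded_op_eqI\<close>)

text \<open>\<open>coeff_reindex_op\<close> with the swap yields a bounded operator matching the
  description, and \<open>bounded_op_eqI\<close> makes it the only one.\<close>

lemma cinner_tensor_flip: "cinner (tensor_flip t x) (E (m, n)) = cinner x (E (n, m))"
proof -
  obtain F where F: "bounded_op_on UNIV F"
    and c: "\<And>x p. cinner (F x) (E p) = cinner x (E (snd p, fst p))"
    using coeff_reindex_op[of "\<lambda>p. (snd p, fst p)" UNIV] by (auto simp: inj_on_def)
  have "F (t u v) = t v u" for u v
    by (rule eq_coeffI) (simp add: c cinner_t_E mult.commute)
  then have "tensor_flip t = F"
    unfolding tensor_flip_def using F by (intro the_equality) (auto intro!: bounded_op_eqI)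
  then show ?thesis by (simp add: c)
qed

text \<open>Both products lower or raise one index and do the opposite to the other one, so each acts on
  coefficients by an injective partial reindexing.\<close>

lemma tensor_op_shift:
  shows bounded_op_shift_adj: "bounded_op_on UNIV (tensor_op t shift (cadjoint shift))"
    and norm_shift_adj: "norm (tensor_op t shift (cadjoint shift) x) \<le> norm x"
    and cinner_shift_adj: "cinner (tensor_op t shift (cadjoint shift) x) (E (m, n)) =
      (case m of 0 \<Rightarrow> 0 | Suc m' \<Rightarrow> cinner x (E (m', Suc n)))"
proof -
  \<comment> \<open>Coefficients with first index 0 are set to 0, since a shifted function has no
    constant term; on the rest the truncated predecessor is a true one, hence injective.\<close>
  have inj: "inj_on (\<lambda>p :: nat \<times> nat. (fst p - 1, Suc (snd p))) {p. fst p > 0}"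
    by (auto simp: inj_on_def prod_eq_iff)
  obtain F where F: "bounded_op_on UNIV F" "\<And>x. norm (F x) \<le> norm x"
    and c: "\<And>x p. cinner (F x) (E p) =
      (if p \<in> {p. fst p > 0} then cinner x (E (fst p - 1, Suc (snd p))) else 0)"
    using coeff_reindex_op[OF inj] by blast
  have "F (t u v) = t (shift u) (cadjoint shift v)" for u v
    by (rule eq_coeffI)
      (auto simp: c cinner_t_E hcoeff_shift hcoeff_cadjoint_shift split: nat.split)
  then have eq: "tensor_op t shift (cadjoint shift) = F" using F(1) by (intro tensor_op_eqI)
  show "bounded_op_on UNIV (tensor_op t shift (cadjoint shift))"
    "norm (tensor_op t shift (cadjoint shift) x) \<le> norm x"
    "cinner (tensor_op t shift (cadjoint shift) x) (E (m, n)) =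
      (case m of 0 \<Rightarrow> 0 | Suc m' \<Rightarrow> cinner x (E (m', Suc n)))"
    unfolding eq using F by (auto simp: c split: nat.split)
qed

lemma tensor_op_adj_shift:
  shows bounded_op_adj_shift: "bounded_op_on UNIV (tensor_op t (cadjoint shift) shift)"
    and norm_adj_shift: "norm (tensor_op t (cadjoint shift) shift x) \<le> norm x"
    and cinner_adj_shift: "cinner (tensor_op t (cadjoint shift) shift x) (E (m, n)) =
      (case n of 0 \<Rightarrow> 0 | Suc n' \<Rightarrow> cinner x (E (Suc m, n')))"
proof -
  have inj: "inj_on (\<lambda>p :: nat \<times> nat. (Suc (fst p), snd p - 1)) {p. snd p > 0}"
    by (auto simp: inj_on_def prod_eq_iff)
  obtain F where F: "bounded_op_on UNIV F" "\<And>x. norm (F x) \<le> norm x"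
    and c: "\<And>x p. cinner (F x) (E p) =
      (if p \<in> {p. snd p > 0} then cinner x (E (Suc (fst p), snd p - 1)) else 0)"
    using coeff_reindex_op[OF inj] by blast
  have "F (t u v) = t (cadjoint shift u) (shift v)" for u v
    by (rule eq_coeffI)
      (auto simp: c cinner_t_E hcoeff_shift hcoeff_cadjoint_shift split: nat.split)
  then have eq: "tensor_op t (cadjoint shift) shift = F" using F(1) by (intro tensor_op_eqI)
  show "bounded_op_on UNIV (tensor_op t (cadjoint shift) shift)"
    "norm (tensor_op t (cadjoint shift) shift x) \<le> norm x"
    "cinner (tensor_op t (cadjoint shift) shift x) (E (m, n)) =
      (case n of 0 \<Rightarrow> 0 | Suc n' \<Rightarrow> cinner x (E (Suc m, n')))"
    unfolding eq using F by (auto simp: c split: nat.split)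
qed

section \<open>The mean of the two products in coordinates\<close>

abbreviation coeff :: "'k \<Rightarrow> nat \<Rightarrow> nat \<Rightarrow> complex" where
  "coeff x m n \<equiv> cinner x (E (m, n))"

lemma coeff_eqI: "(\<And>m n. coeff x m n = coeff y m n) \<Longrightarrow> x = y"
  by (rule eq_coeffI) auto

abbreviation T :: "'k \<Rightarrow> 'k" where
  "T \<equiv> tensor_mean t shift (cadjoint shift)"

lemma coeff_T: "coeff (T x) m n = ((case m of 0 \<Rightarrow> 0 | Suc m' \<Rightarrow> coeff x m' (Suc n))
    + (case n of 0 \<Rightarrow> 0 | Suc n' \<Rightarrow> coeff x (Suc m) n')) / 2"
  by (simp add: tensor_mean_def cinner_simps cinner_shift_adj cinner_adj_shift)

lemma norm_T: "norm (T x) \<le> norm x"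
proof -
  have "norm (T x) \<le> 1 / 2 * (norm x + norm x)"
    unfolding tensor_mean_def norm_scaleC
    by (intro mult_mono norm_triangle_le add_mono norm_shift_adj norm_adj_shift) auto
  then show ?thesis by simp
qed

lemma bounded_op_T: "bounded_op_on UNIV T"
proof -
  have "T (x + y) = T x + T y" "T (c *\<^sub>C x) = c *\<^sub>C T x" for c x y
    using bounded_op_shift_adj bounded_op_adj_shift
    by (auto simp: tensor_mean_def bounded_op_on_def scaleC_add_right scaleC_scaleC mult.commute)
  with norm_T show ?thesis unfolding bounded_op_on_def by (auto intro!: exI[of _ 1])
qed

text \<open>For fixed \<open>x\<close> the condition on \<open>y\<close> defines a closed subspace,
  hence may be checked on the basis, where \<open>T\<close> sends a vertex of the path to half the
  sum of its neighbours.\<close>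

lemma cinner_T: "cinner (T x) y = cinner x (T y)"
proof -
  have "{y. cinner (T x) y = cinner x (T y)} = UNIV"
  proof (rule E_dense)
    have "bounded_linear T" by (rule bounded_op_on_bounded_linear[OF bounded_op_T])
    then show "closed {y. cinner (T x) y = cinner x (T y)}"
      by (intro closed_Collect_eq continuous_on_cinner_right continuous_on_id linear_continuous_on)
    show "complex_vector.subspace {y. cinner (T x) y = cinner x (T y)}"
      using bounded_op_T linear_0[OF bounded_linear.linear[OF bounded_op_on_bounded_linear[OF bounded_op_T]]]
      by (intro complex_vector.subspaceI) (auto simp: bounded_op_on_def cinner_simps)
    fix p :: "nat \<times> nat"
    obtain m n where p: "p = (m, n)" by fastforce
    have "T (E (m, n)) = (1 / 2) *\<^sub>C
        ((case m of 0 \<Rightarrow> 0 | Suc m' \<Rightarrow> E (m', Suc n)) + (case n of 0 \<Rightarrow> 0 | Suc n' \<Rightarrow> E (Suc m, n')))"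
      by (rule coeff_eqI) (auto simp: coeff_T cinner_simps cinner_E split: nat.split)
    then show "E p \<in> {y. cinner (T x) y = cinner x (T y)}"
      unfolding p by (auto simp: coeff_T cinner_simps split: nat.split)
  qed
  then show ?thesis by blast
qed

section \<open>Symmetric and antisymmetric tensors\<close>

text \<open>The two cases are treated together, with the sign \<open>s = 1\<close> for symmetric and \<open>s = -1\<close> for
  antisymmetric tensors.\<close>

definition sgn_space :: "complex \<Rightarrow> 'k set" where
  "sgn_space s = {x. \<forall>m n. coeff x n m = s * coeff x m n}"

lemma sgn_spaceI: "(\<And>m n. coeff x n m = s * coeff x m n) \<Longrightarrow> x \<in> sgn_space s"
  unfolding sgn_space_def by blast

lemma sgn_spaceD: "x \<in> sgn_space s \<Longrightarrow> coeff x n m = s * coeff x m n"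
  unfolding sgn_space_def by blast

lemma tensor_flip_eq_iff: "tensor_flip t x = s *\<^sub>C x \<longleftrightarrow> x \<in> sgn_space s"
proof
  assume "tensor_flip t x = s *\<^sub>C x"
  then show "x \<in> sgn_space s"
    by (intro sgn_spaceI) (metis cinner_tensor_flip cinner_scaleC_left)
next
  assume "x \<in> sgn_space s"
  then show "tensor_flip t x = s *\<^sub>C x"
    by (intro coeff_eqI) (unfold cinner_tensor_flip cinner_scaleC_left, rule sgn_spaceD)
qed

lemma sym_space_eq: "sym_space t = sgn_space 1"
  by (auto simp: sym_space_def simp flip: tensor_flip_eq_iff)

lemma alt_space_eq: "alt_space t = sgn_space (- 1)"
  by (auto simp: alt_space_def simp flip: tensor_flip_eq_iff)

lemma subspace_sgn_space: "complex_vector.subspace (sgn_space s)"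
proof (intro complex_vector.subspaceI sgn_spaceI)
  fix x y c m n assume x: "x \<in> sgn_space s"
  show "coeff (c *\<^sub>C x) n m = s * coeff (c *\<^sub>C x) m n"
    using sgn_spaceD[OF x, of n m] by (simp add: cinner_simps)
  assume y: "y \<in> sgn_space s"
  show "coeff (x + y) n m = s * coeff (x + y) m n"
    using sgn_spaceD[OF x, of n m] sgn_spaceD[OF y, of n m] by (simp add: cinner_simps distrib_left)
qed simp

text \<open>Interchanging \<open>m\<close> and \<open>n\<close> interchanges the two summands of
  \<open>coeff_T\<close>.\<close>

lemma T_in_sgn_space:
  assumes x: "x \<in> sgn_space s"
  shows "T x \<in> sgn_space s"
proof (rule sgn_spaceI)
  fix m n
  show "coeff (T x) n m = s * coeff (T x) m n"
    using sgn_spaceD[OF x, of "n - 1" "Suc m"] sgn_spaceD[OF x, of "Suc n" "m - 1"]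
    by (cases m; cases n) (simp_all add: coeff_T distrib_left)
qed

text \<open>\<open>A\<close> is tied to \<open>T\<close> on the subspace alone, because the
  operators in the theorem come from \<open>restrict\<close> and are \<open>undefined\<close>
  elsewhere.\<close>

lemma sgn_space_contraction:
  assumes A: "\<And>x. x \<in> sgn_space s \<Longrightarrow> A x = T x"
  shows "selfadjoint_contraction (sgn_space s) A"
proof
  show "closed (sgn_space s)"
    unfolding sgn_space_def
    by (intro closed_Collect_all closed_Collect_eq continuous_on_mult continuous_on_const
        continuous_on_cinner_left continuous_on_id)
  note S = subspace_sgn_space[of s]
  then show "complex_vector.subspace (sgn_space s)" .
  show "norm (A x) \<le> norm x" if "x \<in> sgn_space s" for x
    using A norm_T that by simp
  have "T (x + y) = T x + T y" "T (c *\<^sub>C x) = c *\<^sub>C T x" for c x y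
    using bounded_op_T unfolding bounded_op_on_def by auto
  moreover have "\<forall>x\<in>sgn_space s. norm (A x) \<le> 1 * norm x" using A norm_T by simp
  ultimately show "selfadjoint_on (sgn_space s) A"
    unfolding selfadjoint_on_def is_adjoint_on_def bounded_op_on_def
    using A T_in_sgn_space complex_vector.subspace_add[OF S] complex_vector.subspace_scale[OF S]
    by (auto simp: cinner_T intro!: exI[of _ 1])
qed

end

section \<open>Path recurrences\<close>

text \<open>\<open>b\<close> is one line of coefficients extended by a zero at each end. The
  recurrence is that of \<open>sin (i * \<theta>)\<close>, so \<open>b i\<close> is proportional to
  it; the zero at the far end forces \<open>(N + 2) * \<theta>\<close> to be a multiple of
  \<open>pi\<close>, and the last interior value compared with the first reveals the parity of
  \<open>j\<close>.\<close>

lemma path_recurrence: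
  fixes b :: "nat \<Rightarrow> complex"
  assumes b0: "b 0 = 0" and rec: "\<And>i. i \<le> N \<Longrightarrow> b (i + 2) = 2 * complex_of_real (cos \<theta>) * b (i + 1) - b i"
    and end0: "b (N + 2) = 0" and b1: "b 1 \<noteq> 0" and \<theta>: "0 \<le> \<theta>" "\<theta> \<le> pi"
  obtains j :: nat where "1 \<le> j" "j \<le> N + 1" "\<theta> = real j * pi / (real N + 2)"
    "b (N + 1) = (- 1) ^ (j + 1) * b 1"
proof -
  define r where "r = cos \<theta>"
  have rec': "b (Suc (Suc i)) = 2 * complex_of_real r * b (Suc i) - b i" if "i \<le> N" for i
    using rec[OF that] by (simp add: r_def)
  \<comment> \<open>For \<open>\<theta>\<close> equal to 0 or \<open>pi\<close> the solution
    degenerates to \<open>i * r ^ (i + 1) * b 1\<close> with \<open>r\<close> equal to 1 or -1,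
    which cannot vanish at \<open>N + 2\<close>.\<close>
  have s0: "sin \<theta> \<noteq> 0"
  proof
    assume "sin \<theta> = 0"
    then have r2: "r * r = 1" using sin_cos_squared_add3[of \<theta>] by (simp add: r_def)
    have "i \<le> N + 2 \<longrightarrow> b i = complex_of_real (real i * r ^ (i + 1)) * b 1" for i
    proof (induction i rule: induct_nat_012)
      case (ge2 i)
      have "2 * r * (real (Suc i) * r ^ (Suc i + 1)) - real i * r ^ (i + 1)
          = r ^ (i + 1) * (2 * real (Suc i) * (r * r) - real i)"
        by (simp add: algebra_simps)
      also have "\<dots> = r ^ (i + 1) * (r * r) * real (Suc (Suc i))"
        by (simp add: r2)
      finally have "2 * r * (real (Suc i) * r ^ (Suc i + 1)) - real i * r ^ (i + 1)
          = real (Suc (Suc i)) * r ^ (Suc (Suc i) + 1)" by (simp add: mult_ac)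
      then have "complex_of_real (real (Suc (Suc i)) * r ^ (Suc (Suc i) + 1)) * b 1
          = 2 * complex_of_real r * (complex_of_real (real (Suc i) * r ^ (Suc i + 1)) * b 1)
            - complex_of_real (real i * r ^ (i + 1)) * b 1"
        by (metis (no_types, opaque_lifting) left_diff_distrib mult.assoc of_real_diff of_real_mult of_real_numeral)
      then show ?case using ge2 rec'[of i] by auto
    qed (use b0 r2 in auto)
    then have "complex_of_real (real (N + 2) * r ^ (N + 2 + 1)) * b 1 = 0"
      using end0 by (metis le_refl)
    moreover have "real (N + 2) * r ^ (N + 2 + 1) \<noteq> 0" using r2 by auto
    ultimately show False using b1 by (metis mult_eq_0_iff of_real_eq_0_iff)
  qed
  have sol: "i \<le> N + 2 \<longrightarrow> complex_of_real (sin \<theta>) * b i = complex_of_real (sin (real i * \<theta>)) * b 1" for i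
  proof (induction i rule: induct_nat_012)
    case (ge2 i)
    have "sin (real (Suc (Suc i)) * \<theta>) = 2 * r * sin (real (Suc i) * \<theta>) - sin (real i * \<theta>)"
    proof -
      have "real (Suc (Suc i)) * \<theta> = real (Suc i) * \<theta> + \<theta>" "real i * \<theta> = real (Suc i) * \<theta> - \<theta>"
        by (simp_all add: algebra_simps)
      then show ?thesis by (simp only: sin_add sin_diff r_def) simp
    qed
    then have e: "complex_of_real (sin (real (Suc (Suc i)) * \<theta>))
        = 2 * complex_of_real r * complex_of_real (sin (real (Suc i) * \<theta>)) - complex_of_real (sin (real i * \<theta>))"
      by (simp only: of_real_diff of_real_mult of_real_numeral)
    show ?case
    proof
      assume i: "Suc (Suc i) \<le> N + 2"
      then have "complex_of_real (sin \<theta>) * b (Suc (Suc i))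
          = 2 * complex_of_real r * (complex_of_real (sin \<theta>) * b (Suc i)) - complex_of_real (sin \<theta>) * b i"
        by (subst rec') (simp_all add: algebra_simps)
      also have "\<dots> = complex_of_real (sin (real (Suc (Suc i)) * \<theta>)) * b 1"
        using ge2 i unfolding e by (simp add: algebra_simps)
      finally show "complex_of_real (sin \<theta>) * b (Suc (Suc i)) = complex_of_real (sin (real (Suc (Suc i)) * \<theta>)) * b 1" .
    qed
  qed (use b0 in auto)
  have "sin (real (N + 2) * \<theta>) = 0" using sol[of "N + 2"] end0 b1 by simp
  then obtain k :: int where k: "real (N + 2) * \<theta> = real_of_int k * pi"
    by (auto simp: sin_zero_iff_int2)
  have \<theta>': "0 < \<theta>" "\<theta> < pi"
    using \<theta> s0 by (auto simp: less_le)
  have "0 < real_of_int k * pi" unfolding k[symmetric] using \<theta>' by simp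
  then have k0: "0 < k" by (simp add: zero_less_mult_iff)
  have "real_of_int k * pi < real (N + 2) * pi" unfolding k[symmetric] using \<theta>' by simp
  then have k1: "k < int N + 2" by (simp add: mult_less_cancel_right)
  define j where "j = nat k"
  have jk: "real j = real_of_int k" using k0 by (simp add: j_def)
  have \<theta>j: "\<theta> = real j * pi / (real N + 2)" using k by (simp add: jk field_simps)
  \<comment> \<open>At the last interior index the angle is \<open>j * pi - \<theta>\<close>: this
    is where the sign \<open>(- 1) ^ (j + 1)\<close> arises.\<close>
  have "real (N + 1) * \<theta> = real j * pi - \<theta>" using k by (simp add: jk algebra_simps)
  then have "sin (real (N + 1) * \<theta>) = (- 1) ^ (j + 1) * sin \<theta>"
    by (simp add: sin_diff)
  then have "complex_of_real (sin \<theta>) * b (N + 1) = complex_of_real (sin \<theta>) * ((- 1) ^ (j + 1) * b 1)"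
    using sol[of "N + 1"] by (simp add: mult_ac)
  then have "b (N + 1) = (- 1) ^ (j + 1) * b 1"
    using s0 by (metis mult_left_cancel of_real_eq_0_iff)
  moreover have "1 \<le> j" "j \<le> N + 1" using k0 k1 by (auto simp: j_def)
  ultimately show ?thesis using \<theta>j that by blast
qed

section \<open>Dimensions and multiplicities\<close>

lemma edim_zero: "edim {0 :: 'a::complex_vector} = 0"
proof -
  have "cspan ({} :: 'a set) = {0}" by (rule complex_vector.span_empty)
  moreover have "cdim {0 :: 'a} = 0"
    by (rule complex_vector.dim_unique[of "{}"]) (auto simp: complex_vector.independent_empty)
  ultimately show ?thesis unfolding edim_def by (auto simp: zero_enat_def intro: exI[of _ "{}"])
qed

text \<open>Pairing with \<open>z i\<close> kills every \<open>w k\<close> with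
  \<open>k \<noteq> i\<close> but not \<open>w i\<close>, so no \<open>w i\<close> lies in the span
  of the others; an infinite independent set excludes a finite spanning set.\<close>

lemma edim_infinity:
  fixes w :: "nat \<Rightarrow> 'a::complex_inner"
  assumes w: "\<And>i. w i \<in> V" and nz: "\<And>i. cinner (w i) (z i) \<noteq> 0"
    and ortho: "\<And>i k. i \<noteq> k \<Longrightarrow> cinner (w i) (z k) = 0"
  shows "edim V = \<infinity>"
proof -
  have "inj w"
    by (rule injI) (metis nz ortho)
  then have inf: "infinite (range w)" by (rule range_inj_infinite)
  have indep: "\<not> complex_vector.dependent (range w)"
    unfolding complex_vector.dependent_def
  proof (rule notI, elim bexE)
    fix a assume "a \<in> range w" and a: "a \<in> cspan (range w - {a})"
    then obtain i where i: "a = w i" by blast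
    have "cspan (range w - {a}) \<subseteq> {y. cinner y (z i) = 0}"
    proof (rule complex_vector.span_minimal)
      show "range w - {a} \<subseteq> {y. cinner y (z i) = 0}" using ortho by (clarsimp simp: i) metis
    qed (rule complex_vector.subspaceI; simp add: cinner_simps)
    with a nz[of i] i show False by auto
  qed
  have "\<not> (\<exists>B. finite B \<and> cspan B = V)"
  proof
    assume "\<exists>B. finite B \<and> cspan B = V"
    then obtain B where B: "finite B" "cspan B = V" by blast
    have "range w \<subseteq> cspan B" using w B(2) by auto
    from complex_vector.independent_span_bound[OF B(1) indep this] inf show False by blast
  qed
  then show ?thesis by (simp add: edim_def)
qed

text \<open>The index set of the eigenvalue \<open>\<mu>\<close>: \<open>N\<close> is the degree of the block \<open>span {E (m, n) | m + n = N}\<close>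
  and \<open>s\<close> the sign of its \<open>j\<close>-th eigenvector under the flip.\<close>

definition eig_indices :: "complex \<Rightarrow> complex \<Rightarrow> (nat \<times> nat) set" where
  "eig_indices s \<mu> = {(N, j). 1 \<le> j \<and> j \<le> N + 1 \<and> (- 1) ^ (j + 1) = s \<and>
     complex_of_real (cos (real j * pi / (real N + 2))) = \<mu>}"

text \<open>An odd factor keeps the quotient \<open>j / (N + 2)\<close> and the parity of
  \<open>j\<close>, hence both the eigenvalue and the sign; an even factor would make every
  \<open>j\<close> even. The scaled quantity is \<open>N + 2\<close>, whence the subtraction of
  2.\<close>

lemma eig_indices_odd_multiple:
  assumes "(N, j) \<in> eig_indices s \<mu>"
  shows "((2 * l + 1) * (N + 2) - 2, (2 * l + 1) * j) \<in> eig_indices s \<mu>"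
proof -
  define q where "q = 2 * l + 1"
  have j: "1 \<le> j" "j \<le> N + 1" using assms by (auto simp: eig_indices_def)
  have q1: "1 \<le> q" by (simp add: q_def)
  have ge: "2 \<le> q * (N + 2)" using mult_le_mono[OF q1, of 2 "N + 2"] by simp
  have "q * j \<le> q * (N + 1)" using j by (intro mult_le_mono) auto
  also have "\<dots> \<le> q * (N + 2) - 2 + 1" using q1 ge by (simp add: algebra_simps)
  finally have "q * j \<le> q * (N + 2) - 2 + 1" .
  moreover have "1 \<le> q * j" using q1 j mult_le_mono[of 1 q 1 j] by simp
  moreover have "(- 1 :: complex) ^ (q * j + 1) = (- 1) ^ (j + 1)"
    by (simp add: q_def uminus_power_if)
  moreover have "real (q * (N + 2) - 2) + 2 = real q * (real N + 2)"
    using ge by (simp add: of_nat_diff algebra_simps)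
  then have "real (q * j) * pi / (real (q * (N + 2) - 2) + 2) = real j * pi / (real N + 2)"
    using q1 by simp
  ultimately show ?thesis
    using assms unfolding q_def[symmetric] eig_indices_def by auto
qed

text \<open>The degrees themselves are distinct, not only the pairs: the eigenvectors then live in
  different blocks, where the vectors \<open>E (0, N l)\<close> tell them apart.\<close>

lemma eig_indices_sequence:
  assumes "eig_indices s \<mu> \<noteq> {}"
  obtains N j :: "nat \<Rightarrow> nat" where "inj N" "\<And>l. (N l, j l) \<in> eig_indices s \<mu>"
proof -
  obtain N j where Nj: "(N, j) \<in> eig_indices s \<mu>" using assms by auto
  have "inj (\<lambda>l. (2 * l + 1) * (N + 2) - 2)"
  proof (rule injI)
    fix l l' :: nat assume eq: "(2 * l + 1) * (N + 2) - 2 = (2 * l' + 1) * (N + 2) - 2"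
    have "2 \<le> (2 * l + 1) * (N + 2)" for l by (simp add: algebra_simps)
    from this[of l] this[of l'] eq have "(2 * l + 1) * (N + 2) = (2 * l' + 1) * (N + 2)" by linarith
    then have "2 * l + 1 = 2 * l' + 1" by (subst (asm) mult_cancel2) simp
    then show "l = l'" by simp
  qed
  from that[OF this eig_indices_odd_multiple[OF Nj]] show ?thesis .
qed

lemma ecard_image_eig_indices:
  assumes "inj_on h (eig_indices s \<mu>)"
  shows "ecard (h ` eig_indices s \<mu>) = (if eig_indices s \<mu> = {} then 0 else \<infinity>)"
proof (cases "eig_indices s \<mu> = {}")
  case False
  then obtain N j :: "nat \<Rightarrow> nat" where N: "inj N" "\<And>l. (N l, j l) \<in> eig_indices s \<mu>"
    by (metis eig_indices_sequence)
  have "inj (\<lambda>l. (N l, j l))" using N(1) by (auto simp: inj_def)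
  then have "infinite (range (\<lambda>l. (N l, j l)))" by (rule range_inj_infinite)
  moreover have "range (\<lambda>l. (N l, j l)) \<subseteq> eig_indices s \<mu>" using N(2) by auto
  ultimately have "infinite (eig_indices s \<mu>)" using finite_subset by blast
  then show ?thesis using False assms by (simp add: ecard_def finite_image_iff)
qed (simp add: ecard_def zero_enat_def)

text \<open>Sign 1 means odd \<open>j\<close>, so \<open>(j + 1) div 2\<close> is the
  \<open>l\<close> with \<open>j = 2 * l - 1\<close>, and \<open>j \<le> N + 1\<close> becomes
  \<open>2 * l \<le> N + 2\<close>.\<close>

lemma sym_family:
  "family_emultiset {(k :: int, j :: int). k \<ge> 0 \<and> 1 \<le> j \<and> j \<le> \<lfloor>(real_of_int k + 2) / 2\<rfloor>}
      (\<lambda>(k, j). complex_of_real (cos ((2 * real_of_int j - 1) * pi / (real_of_int k + 2)))) \<mu>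
    = (if eig_indices 1 \<mu> = {} then 0 else \<infinity>)"
proof -
  let ?h = "\<lambda>(N :: nat, j :: nat). (int N, (int j + 1) div 2)"
  have odd: "\<exists>i. j = 2 * i + 1" if "(N, j) \<in> eig_indices 1 \<mu>" for N j
  proof -
    have "(- 1 :: complex) ^ (j + 1) = 1"
      using that by (simp add: eig_indices_def)
    then have "odd j" by (simp add: uminus_power_if split: if_splits)
    then show ?thesis by (rule oddE) auto
  qed
  have inj: "inj_on ?h (eig_indices 1 \<mu>)"
    by (rule inj_onI) (auto dest!: odd)
  have fl: "j \<le> \<lfloor>(real_of_int k + 2) / 2\<rfloor> \<longleftrightarrow> 2 * j \<le> k + 2" for j k :: int
  proof -
    have "real_of_int j \<le> (real_of_int k + 2) / 2 \<longleftrightarrow> real_of_int (2 * j) \<le> real_of_int (k + 2)"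
      by auto
    then show ?thesis unfolding le_floor_iff of_int_le_iff .
  qed
  have "{i \<in> {(k :: int, j :: int). k \<ge> 0 \<and> 1 \<le> j \<and> j \<le> \<lfloor>(real_of_int k + 2) / 2\<rfloor>}.
      (case i of (k, j) \<Rightarrow> complex_of_real (cos ((2 * real_of_int j - 1) * pi / (real_of_int k + 2)))) = \<mu>}
    = ?h ` eig_indices 1 \<mu>" (is "?L = ?R")
  proof (intro subset_antisym subsetI)
    fix p assume p: "p \<in> ?L"
    obtain k j where pkj: "p = (k, j)" by fastforce
    have kj: "0 \<le> k" "1 \<le> j" "2 * j \<le> k + 2"
      "complex_of_real (cos ((2 * real_of_int j - 1) * pi / (real_of_int k + 2))) = \<mu>"
      using p fl by (auto simp: pkj)
    define N i where "N = nat k" and "i = nat (j - 1)"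
    have k: "k = int N" and j: "j = int i + 1" using kj by (auto simp: N_def i_def)
    have "(N, 2 * i + 1) \<in> eig_indices 1 \<mu>"
      using kj by (simp add: eig_indices_def k j algebra_simps)
    moreover have "p = ?h (N, 2 * i + 1)" by (simp add: pkj k j)
    ultimately show "p \<in> ?R" by (rule rev_image_eqI)
  next
    fix p assume "p \<in> ?R"
    then obtain N j where Nj: "(N, j) \<in> eig_indices 1 \<mu>" "p = ?h (N, j)" by auto
    obtain i where "j = 2 * i + 1" using odd[OF Nj(1)] by blast
    with Nj show "p \<in> ?L" by (auto simp: fl eig_indices_def algebra_simps)
  qed
  then show ?thesis unfolding family_emultiset_def
    using ecard_image_eig_indices[OF inj] by simp
qed

text \<open>Sign -1 means even \<open>j\<close>, which is halved. Degree 0 contributes nothing, its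
  only candidate \<open>j = 1\<close> being odd; hence \<open>k\<close> starts at 1.\<close>

lemma alt_family:
  "family_emultiset {(k :: int, j :: int). k \<ge> 1 \<and> 1 \<le> j \<and> j \<le> \<lfloor>(real_of_int k + 1) / 2\<rfloor>}
      (\<lambda>(k, j). complex_of_real (cos (2 * real_of_int j * pi / (real_of_int k + 2)))) \<mu>
    = (if eig_indices (- 1) \<mu> = {} then 0 else \<infinity>)"
proof -
  let ?h = "\<lambda>(N :: nat, j :: nat). (int N, int j div 2)"
  have even: "\<exists>i. j = 2 * i" if "(N, j) \<in> eig_indices (- 1) \<mu>" for N j
  proof -
    have "(- 1 :: complex) ^ (j + 1) = - 1"
      using that by (simp add: eig_indices_def)
    then have "even j" by (simp add: uminus_power_if split: if_splits)
    then show ?thesis by (rule evenE) auto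
  qed
  have inj: "inj_on ?h (eig_indices (- 1) \<mu>)"
    by (rule inj_onI) (auto dest!: even)
  have fl: "j \<le> \<lfloor>(real_of_int k + 1) / 2\<rfloor> \<longleftrightarrow> 2 * j \<le> k + 1" for j k :: int
  proof -
    have "real_of_int j \<le> (real_of_int k + 1) / 2 \<longleftrightarrow> real_of_int (2 * j) \<le> real_of_int (k + 1)"
      by auto
    then show ?thesis unfolding le_floor_iff of_int_le_iff .
  qed
  have "{i \<in> {(k :: int, j :: int). k \<ge> 1 \<and> 1 \<le> j \<and> j \<le> \<lfloor>(real_of_int k + 1) / 2\<rfloor>}.
      (case i of (k, j) \<Rightarrow> complex_of_real (cos (2 * real_of_int j * pi / (real_of_int k + 2)))) = \<mu>}
    = ?h ` eig_indices (- 1) \<mu>" (is "?L = ?R")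
  proof (intro subset_antisym subsetI)
    fix p assume p: "p \<in> ?L"
    obtain k j where pkj: "p = (k, j)" by fastforce
    have kj: "1 \<le> k" "1 \<le> j" "2 * j \<le> k + 1"
      "complex_of_real (cos (2 * real_of_int j * pi / (real_of_int k + 2))) = \<mu>"
      using p fl by (auto simp: pkj)
    define N i where "N = nat k" and "i = nat j"
    have k: "k = int N" and j: "j = int i" using kj by (auto simp: N_def i_def)
    have "(N, 2 * i) \<in> eig_indices (- 1) \<mu>"
      using kj by (simp add: eig_indices_def k j algebra_simps)
    moreover have "p = ?h (N, 2 * i)" by (simp add: pkj k j)
    ultimately show "p \<in> ?R" by (rule rev_image_eqI)
  next
    fix p assume "p \<in> ?R"
    then obtain N j where Nj: "(N, j) \<in> eig_indices (- 1) \<mu>" "p = ?h (N, j)" by auto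
    obtain i where "j = 2 * i" using even[OF Nj(1)] by blast
    with Nj show "p \<in> ?L" by (auto simp: fl eig_indices_def mult_ac)
  qed
  then show ?thesis unfolding family_emultiset_def
    using ecard_image_eig_indices[OF inj] by simp
qed

text \<open>\<open>u\<close> stands for an angle divided by \<open>pi\<close>. With \<open>i\<close>
  an integer near \<open>(n + 1) * u\<close>, both \<open>(2 * i - 1) / (2 * n + 2)\<close> and
  \<open>2 * i / (2 * n + 3)\<close> approximate \<open>u\<close>, one for each parity of
  \<open>j\<close>: either numerator misses \<open>(N + 2) * u\<close> by at most 3.\<close>

lemma eig_indices_approx:
  assumes u: "0 \<le> u" "u \<le> 1" and s: "s = 1 \<or> s = - 1"
  obtains N j :: nat where "(N, j) \<in> eig_indices s (complex_of_real (cos (real j * pi / (real N + 2))))"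
    "\<bar>real j / (real N + 2) - u\<bar> \<le> 3 / real (n + 1)"
proof -
  define f where "f = \<lfloor>real (n + 1) * u\<rfloor>"
  \<comment> \<open>Floor plus one, clamped so that \<open>i \<le> n + 1\<close> and
    \<open>j\<close> stays admissible; the clamp acts at \<open>u = 1\<close>.\<close>
  define i where "i = nat (min (int n + 1) (f + 1))"
  have "0 \<le> real (n + 1) * u" using u by simp
  then have f0: "0 \<le> f" unfolding f_def by simp
  have f1: "real_of_int f \<le> real (n + 1) * u" "real (n + 1) * u < real_of_int f + 1"
    unfolding f_def by linarith+
  have nu: "real (n + 1) * u \<le> real (n + 1)" using u by (intro mult_left_le) auto
  have i: "1 \<le> i" "i \<le> n + 1" using f0 by (auto simp: i_def)
  have "real i = min (real (n + 1)) (real_of_int f + 1)"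
    using f0 by (simp add: i_def min_def)
  then have iu: "\<bar>real i - real (n + 1) * u\<bar> \<le> 1"
    using nu f1 by (auto simp: min_def abs_le_iff split: if_splits)
  have est: "\<bar>x / d - u\<bar> \<le> 3 / real (n + 1)" if "\<bar>x - d * u\<bar> \<le> 3" "real (n + 1) \<le> d" for x d
  proof -
    have d: "0 < d" using that(2) by linarith
    have "x / d - u = (x - d * u) / d" using d by (simp add: field_simps)
    then have "\<bar>x / d - u\<bar> = \<bar>x - d * u\<bar> / d" using d by simp
    also have "\<dots> \<le> 3 / d" using that d by (intro divide_right_mono) auto
    also have "\<dots> \<le> 3 / real (n + 1)" using that(2) by (intro divide_left_mono) auto
    finally show ?thesis .
  qed
  show ?thesis
    using s
  proof
    assume s: "s = 1"
    show ?thesis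
    proof (rule that[of "2 * n" "2 * i - 1"])
      show "(2 * n, 2 * i - 1) \<in> eig_indices s
          (complex_of_real (cos (real (2 * i - 1) * pi / (real (2 * n) + 2))))"
        using i by (auto simp: eig_indices_def s)
      show "\<bar>real (2 * i - 1) / (real (2 * n) + 2) - u\<bar> \<le> 3 / real (n + 1)"
        by (rule est) (use iu i in \<open>auto simp: of_nat_diff algebra_simps abs_le_iff\<close>)
    qed
  next
    assume s: "s = - 1"
    show ?thesis
    \<comment> \<open>The degree is \<open>2 * n + 1\<close> instead of \<open>2 * n\<close> because
      the largest value \<open>j = 2 * n + 2\<close> must not exceed \<open>N + 1\<close>.\<close>
    proof (rule that[of "2 * n + 1" "2 * i"])
      show "(2 * n + 1, 2 * i) \<in> eig_indices s
          (complex_of_real (cos (real (2 * i) * pi / (real (2 * n + 1) + 2))))"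
        using i by (auto simp: eig_indices_def s)
      show "\<bar>real (2 * i) / (real (2 * n + 1) + 2) - u\<bar> \<le> 3 / real (n + 1)"
      proof (rule est)
        define e where "e = real i - real (n + 1) * u"
        have "real (2 * i) - (real (2 * n + 1) + 2) * u = 2 * e - u" "\<bar>e\<bar> \<le> 1"
          using iu by (simp_all add: e_def algebra_simps)
        then show "\<bar>real (2 * i) - (real (2 * n + 1) + 2) * u\<bar> \<le> 3" using u by linarith
      qed simp
    qed
  qed
qed

section \<open>Eigenvectors\<close>

context hardy_tensor
begin

definition evec :: "nat \<Rightarrow> nat \<Rightarrow> 'k" where
  "evec N j = (\<Sum>m\<le>N. complex_of_real (sin (real (m + 1) * (real j * pi / (real N + 2)))) *\<^sub>C E (m, N - m))"

lemma coeff_evec: "coeff (evec N j) m n =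
    (if m + n = N then complex_of_real (sin (real (m + 1) * (real j * pi / (real N + 2)))) else 0)"
proof -
  let ?a = "\<lambda>m. complex_of_real (sin (real (m + 1) * (real j * pi / (real N + 2))))"
  have "coeff (evec N j) m n = (\<Sum>i\<le>N. if i = m then (if N - i = n then ?a i else 0) else 0)"
    unfolding evec_def cinner_sum_left
    by (intro sum.cong) (auto simp: cinner_scaleC_left cinner_E)
  also have "\<dots> = (if m \<le> N then (if N - m = n then ?a m else 0) else 0)"
    by (subst sum.delta) auto
  finally show ?thesis by auto
qed

text \<open>Inside the block this is \<open>sin (m * \<theta>) + sin ((m + 2) * \<theta>) = 2 * cos
  \<theta> * sin ((m + 1) * \<theta>)\<close>. At the ends the missing neighbour agrees with
  \<open>sin 0\<close> and \<open>sin ((N + 2) * \<theta>)\<close>, both zero.\<close>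

lemma T_evec: "T (evec N j) = complex_of_real (cos (real j * pi / (real N + 2))) *\<^sub>C evec N j"
proof (rule coeff_eqI)
  fix m n
  define \<theta> where "\<theta> = real j * pi / (real N + 2)"
  have c: "coeff (evec N j) m n = (if m + n = N then complex_of_real (sin (real (m + 1) * \<theta>)) else 0)" for m n
    unfolding coeff_evec \<theta>_def ..
  have "real (N + 2) * \<theta> = real j * pi"
    unfolding \<theta>_def by (simp add: nonzero_mult_div_cancel_left add_nonneg_eq_0_iff add.commute)
  then have end0: "sin (real (N + 2) * \<theta>) = 0" by simp
  show "coeff (T (evec N j)) m n = coeff (complex_of_real (cos (real j * pi / (real N + 2))) *\<^sub>C evec N j) m n"
  proof (cases "m + n = N")
    case True
    have 1: "(case m of 0 \<Rightarrow> 0 | Suc m' \<Rightarrow> coeff (evec N j) m' (Suc n)) = complex_of_real (sin (real m * \<theta>))"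
      using True by (auto simp: c split: nat.split)
    have 2: "(case n of 0 \<Rightarrow> 0 | Suc n' \<Rightarrow> coeff (evec N j) (Suc m) n') = complex_of_real (sin (real (m + 2) * \<theta>))"
      using True end0 by (auto simp: c split: nat.split)
    have "real m * \<theta> = real (m + 1) * \<theta> - \<theta>" "real (m + 2) * \<theta> = real (m + 1) * \<theta> + \<theta>"
      by (simp_all add: algebra_simps)
    then have "sin (real m * \<theta>) + sin (real (m + 2) * \<theta>) = 2 * (cos \<theta> * sin (real (m + 1) * \<theta>))"
      by (simp only: sin_add sin_diff) simp
    then have "complex_of_real (sin (real m * \<theta>)) + complex_of_real (sin (real (m + 2) * \<theta>))
        = 2 * (complex_of_real (cos \<theta>) * complex_of_real (sin (real (m + 1) * \<theta>)))"
      by (metis of_real_add of_real_mult of_real_numeral)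
    then show ?thesis
      unfolding coeff_T 1 2 cinner_scaleC_left \<theta>_def[symmetric] using True by (simp add: c)
  next
    case False
    then show ?thesis unfolding coeff_T cinner_scaleC_left c by (auto split: nat.split)
  qed
qed

text \<open>For \<open>m + n = N\<close> the angles \<open>(m + 1) * \<theta>\<close> and
  \<open>(n + 1) * \<theta>\<close> add up to \<open>j * pi\<close>, so their sines agree up to the
  factor \<open>(- 1) ^ (j + 1)\<close>.\<close>

lemma evec_in_sgn_space:
  assumes "(- 1) ^ (j + 1) = s"
  shows "evec N j \<in> sgn_space s"
proof (rule sgn_spaceI)
  fix m n
  define \<theta> where "\<theta> = real j * pi / (real N + 2)"
  show "coeff (evec N j) n m = s * coeff (evec N j) m n"
  proof (cases "m + n = N")
    case True
    have "real (n + 1) * \<theta> = real (N + 2) * \<theta> - real (m + 1) * \<theta>"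
      using True by (simp add: algebra_simps flip: True)
    also have "real (N + 2) * \<theta> = real j * pi"
      unfolding \<theta>_def by (simp add: nonzero_mult_div_cancel_left add_nonneg_eq_0_iff add.commute)
    finally have "sin (real (n + 1) * \<theta>) = (- 1) ^ (j + 1) * sin (real (m + 1) * \<theta>)"
      by (simp add: sin_diff)
    then show ?thesis
      unfolding coeff_evec \<theta>_def[symmetric] using True
      by (simp add: add.commute flip: assms)
  next
    case False
    then show ?thesis by (simp add: coeff_evec add.commute)
  qed
qed

text \<open>The entry is the sine of an angle strictly between 0 and \<open>pi\<close>. It shows
  both that the vector is nonzero and that \<open>E (0, N)\<close> detects it.\<close>

lemma coeff_evec_nonzero:
  assumes "1 \<le> j" "j \<le> N + 1"
  shows "coeff (evec N j) 0 N \<noteq> 0"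
proof -
  have "real j * pi < pi * (real N + 2)"
    unfolding mult.commute[of pi] using assms by (intro mult_strict_right_mono) auto
  then have "sin (real j * pi / (real N + 2)) > 0"
    using assms by (intro sin_gt_zero) (auto simp: pos_divide_less_eq)
  then show ?thesis by (simp add: coeff_evec)
qed

text \<open>Converse of the eigenvector construction. The eigenvalue equation never mixes degrees,
  so the coefficients of degree \<open>N\<close> solve the path recurrence on their own, and the
  flip symmetry relates the two ends of the path, which fixes the parity of
  \<open>j\<close>.\<close>

lemma eig_indices_nonempty:
  assumes x: "x \<in> sgn_space s" "x \<noteq> 0" and eig: "T x = complex_of_real r *\<^sub>C x"
    and r: "-1 \<le> r" "r \<le> 1"
  shows "eig_indices s (complex_of_real r) \<noteq> {}"
proof -
  obtain p q where pq: "coeff x p q \<noteq> 0" using coeff_eqI[of x 0] x(2) by auto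
  define N where "N = p + q"
  \<comment> \<open>The shift by one puts the zero end values at \<open>0\<close> and
    \<open>N + 2\<close>, as \<open>path_recurrence\<close> expects.\<close>
  define b where "b i = (if i = 0 \<or> N + 1 < i then 0 else coeff x (i - 1) (N + 1 - i))" for i
  have rec: "b (i + 2) = 2 * complex_of_real r * b (i + 1) - b i" if i: "i \<le> N" for i
  proof -
    have "coeff (T x) i (N - i) = complex_of_real r * coeff x i (N - i)"
      by (simp add: eig cinner_scaleC_left)
    moreover have "(case i of 0 \<Rightarrow> 0 | Suc i' \<Rightarrow> coeff x i' (Suc (N - i))) = b i"
      using i by (auto simp: b_def Suc_diff_le split: nat.split)
    moreover have "(case N - i of 0 \<Rightarrow> 0 | Suc n' \<Rightarrow> coeff x (Suc i) n') = b (i + 2)"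
    proof (cases "i = N")
      case False
      then have "N - i = Suc (N - Suc i)" using i by (simp add: Suc_diff_Suc)
      then show ?thesis using i False by (simp add: b_def)
    qed (simp add: b_def)
    moreover have "coeff x i (N - i) = b (i + 1)" using i by (simp add: b_def)
    ultimately show ?thesis unfolding coeff_T by (simp add: field_simps)
  qed
  \<comment> \<open>Two consecutive zeros would propagate along the line and contradict
    \<open>coeff x p q \<noteq> 0\<close>.\<close>
  have b1: "b 1 \<noteq> 0"
  proof
    assume b1: "b 1 = 0"
    have "i \<le> N + 2 \<longrightarrow> b i = 0" for i
      by (induction i rule: induct_nat_012) (use b1 rec in \<open>auto simp: b_def[of 0]\<close>)
    then have "b (p + 1) = 0" by (simp add: N_def)
    then show False using pq by (simp add: b_def N_def)
  qed
  have rc: "cos (arccos r) = r" using r by (rule cos_arccos)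
  obtain j where j: "1 \<le> j" "j \<le> N + 1" "arccos r = real j * pi / (real N + 2)"
    and par: "b (N + 1) = (- 1) ^ (j + 1) * b 1"
  proof (rule path_recurrence[of b N "arccos r"])
    show "b (i + 2) = 2 * complex_of_real (cos (arccos r)) * b (i + 1) - b i" if "i \<le> N" for i
      unfolding rc using that by (rule rec)
  qed (use b1 r in \<open>auto simp: b_def arccos_lbound arccos_ubound\<close>)
  \<comment> \<open>\<open>b 1\<close> and \<open>b (N + 1)\<close> are the coefficients at
    \<open>(0, N)\<close> and \<open>(N, 0)\<close>, which the flip exchanges.\<close>
  have "b (N + 1) = s * b 1" using sgn_spaceD[OF x(1), of N 0] by (simp add: b_def)
  with par b1 have "(- 1) ^ (j + 1) = s" by (metis mult_right_cancel)
  then have "(N, j) \<in> eig_indices s (complex_of_real r)"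
    using j(1,2) rc unfolding j(3) by (auto simp: eig_indices_def)
  then show ?thesis by blast
qed

text \<open>The point spectrum is given in the same 0-or-\<infinity> form as in
  \<open>sym_family\<close> and \<open>alt_family\<close>, so that the multisets match by
  rewriting.\<close>

lemma mean_on_sgn_space:
  assumes s: "s = 1 \<or> s = - 1" and A: "\<And>x. x \<in> sgn_space s \<Longrightarrow> A x = T x"
  shows "selfadjoint_on (sgn_space s) A"
    and "point_spectrum_on (sgn_space s) A \<mu> = (if eig_indices s \<mu> = {} then 0 else \<infinity>)"
    and "spectrum_on (sgn_space s) A = complex_of_real ` {-1..1}"
    and "approx_point_spectrum_on (sgn_space s) A = complex_of_real ` {-1..1}"
    and "op_norm_on (sgn_space s) A = 1"
proof -
  interpret selfadjoint_contraction "sgn_space s" A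
    by (rule sgn_space_contraction[OF A])
  show "selfadjoint_on (sgn_space s) A" by (rule selfadjoint)
  have ev: "evec N j \<in> sgn_space s" "A (evec N j) = \<nu> *\<^sub>C evec N j" "coeff (evec N j) 0 N \<noteq> 0"
    if "(N, j) \<in> eig_indices s \<nu>" for N j \<nu>
  proof -
    show 1: "evec N j \<in> sgn_space s"
      using that by (intro evec_in_sgn_space) (auto simp: eig_indices_def)
    show "A (evec N j) = \<nu> *\<^sub>C evec N j"
      using that A[OF 1] by (auto simp: T_evec eig_indices_def)
    show "coeff (evec N j) 0 N \<noteq> 0"
      using that by (intro coeff_evec_nonzero) (auto simp: eig_indices_def)
  qed
  show "point_spectrum_on (sgn_space s) A \<mu> = (if eig_indices s \<mu> = {} then 0 else \<infinity>)"
  proof (cases "eig_indices s \<mu> = {}")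
    case True
    have "x = 0" if x: "x \<in> sgn_space s" "A x = \<mu> *\<^sub>C x" for x
    proof (rule ccontr)
      assume x0: "x \<noteq> 0"
      obtain r where r: "\<mu> = complex_of_real r" "-1 \<le> r" "r \<le> 1"
        using eigenvalue_real[OF x(1) x0 x(2)] .
      have "eig_indices s \<mu> \<noteq> {}"
        using eig_indices_nonempty[OF x(1) x0 _ r(2,3)] x A r(1) by simp
      with True show False by contradiction
    qed
    moreover have "A 0 = \<mu> *\<^sub>C 0" using contraction[OF M_zero] by simp
    ultimately have "eigenspace_on (sgn_space s) A \<mu> = {0}"
      using M_zero by (auto simp: eigenspace_on_def)
    then show ?thesis using True by (simp add: point_spectrum_on_def edim_zero)
  next
    case False
    then obtain N j :: "nat \<Rightarrow> nat" where N: "inj N" "\<And>l. (N l, j l) \<in> eig_indices s \<mu>"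
      by (metis eig_indices_sequence)
    have "edim (eigenspace_on (sgn_space s) A \<mu>) = \<infinity>"
    proof (rule edim_infinity[where w = "\<lambda>l. evec (N l) (j l)" and z = "\<lambda>l. E (0, N l)"])
      show "evec (N i) (j i) \<in> eigenspace_on (sgn_space s) A \<mu>" for i
        using ev[OF N(2)] by (simp add: eigenspace_on_def)
      show "coeff (evec (N i) (j i)) 0 (N i) \<noteq> 0" for i by (rule ev[OF N(2)])
      show "coeff (evec (N i) (j i)) 0 (N k) = 0" if "i \<noteq> k" for i k
        using that injD[OF N(1), of i k] by (auto simp: coeff_evec)
    qed
    then show ?thesis using False by (simp add: point_spectrum_on_def)
  qed
  have ap: "complex_of_real r \<in> approx_point_spectrum_on (sgn_space s) A" if r: "-1 \<le> r" "r \<le> 1" for r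
  proof -
    \<comment> \<open>Here \<open>r = cos (u * pi)\<close>; admissible fractions converging to
      \<open>u\<close> give eigenvalues converging to \<open>r\<close>.\<close>
    define u where "u = arccos r / pi"
    have u: "0 \<le> u" "u \<le> 1" using r by (simp_all add: u_def arccos_lbound arccos_ubound)
    have "\<exists>N j. (N, j) \<in> eig_indices s (complex_of_real (cos (real j * pi / (real N + 2)))) \<and>
        \<bar>real j / (real N + 2) - u\<bar> \<le> 3 / real (n + 1)" for n :: nat
      using eig_indices_approx[OF u s, of n] by metis
    then obtain N j :: "nat \<Rightarrow> nat"
      where Nj: "\<And>n. (N n, j n) \<in> eig_indices s (complex_of_real (cos (real (j n) * pi / (real (N n) + 2))))"
        and le: "\<And>n. \<bar>real (j n) / (real (N n) + 2) - u\<bar> \<le> 3 / real (n + 1)" by metis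
    have "(\<lambda>n. 3 / real (n + 1)) \<longlonglongrightarrow> 0" by real_asymp
    then have "(\<lambda>n. real (j n) / (real (N n) + 2) - u) \<longlonglongrightarrow> 0"
      by (rule Lim_null_comparison[rotated]) (use le in simp)
    then have "(\<lambda>n. real (j n) / (real (N n) + 2)) \<longlonglongrightarrow> u" by (rule LIM_zero_cancel)
    then have "(\<lambda>n. complex_of_real (cos (real (j n) / (real (N n) + 2) * pi))) \<longlonglongrightarrow> complex_of_real (cos (u * pi))"
      by (intro tendsto_intros)
    moreover have "cos (u * pi) = r" using r by (simp add: u_def cos_arccos)
    ultimately have lim: "(\<lambda>n. complex_of_real (cos (real (j n) * pi / (real (N n) + 2)))) \<longlonglongrightarrow> complex_of_real r"
      by simp
    have "evec (N n) (j n) \<noteq> 0" for n using ev(3)[OF Nj[of n]] by auto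
    with ev(1,2)[OF Nj] lim show ?thesis by (intro approx_eigenvalue)
  qed
  then have "complex_of_real ` {-1..1} \<subseteq> approx_point_spectrum_on (sgn_space s) A" by auto
  \<comment> \<open>The inclusions from the interval to the approximate point spectrum, to the
    spectrum and back to the interval close up.\<close>
  then show "spectrum_on (sgn_space s) A = complex_of_real ` {-1..1}"
    "approx_point_spectrum_on (sgn_space s) A = complex_of_real ` {-1..1}"
    using approx_point_spectrum_subset spectrum_real by blast+
  show "op_norm_on (sgn_space s) A = 1"
    by (rule op_norm_eq_1) (use ap[of 1] in simp)
qed

end

theorem theorem8p1:
  fixes t :: "hardy \<Rightarrow> hardy \<Rightarrow> 'k::complex_hilbert"
  assumes "hilbert_tensor t"
  shows "selfadjoint_on (sym_space t) (sym_tensor_op t shift (cadjoint shift))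
     \<and> selfadjoint_on (alt_space t) (alt_tensor_op t shift (cadjoint shift))
     \<and> point_spectrum_on (sym_space t) (sym_tensor_op t shift (cadjoint shift)) =
        family_emultiset {(k :: int, j :: int). k \<ge> 0 \<and> 1 \<le> j \<and> j \<le> \<lfloor>(real_of_int k + 2) / 2\<rfloor>}
          (\<lambda>(k, j). complex_of_real (cos ((2 * real_of_int j - 1) * pi / (real_of_int k + 2))))
     \<and> point_spectrum_on (alt_space t) (alt_tensor_op t shift (cadjoint shift)) =
        family_emultiset {(k :: int, j :: int). k \<ge> 1 \<and> 1 \<le> j \<and> j \<le> \<lfloor>(real_of_int k + 1) / 2\<rfloor>}
          (\<lambda>(k, j). complex_of_real (cos (2 * real_of_int j * pi / (real_of_int k + 2))))
     \<and> spectrum_on (sym_space t) (sym_tensor_op t shift (cadjoint shift)) =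
        complex_of_real ` {-1..1}
     \<and> approx_point_spectrum_on (sym_space t) (sym_tensor_op t shift (cadjoint shift)) =
        complex_of_real ` {-1..1}
     \<and> spectrum_on (alt_space t) (alt_tensor_op t shift (cadjoint shift)) =
        complex_of_real ` {-1..1}
     \<and> approx_point_spectrum_on (alt_space t) (alt_tensor_op t shift (cadjoint shift)) =
        complex_of_real ` {-1..1}
     \<and> op_norm_on (sym_space t) (sym_tensor_op t shift (cadjoint shift)) = 1
     \<and> op_norm_on (alt_space t) (alt_tensor_op t shift (cadjoint shift)) = 1"
proof -
  interpret hardy_tensor t by unfold_locales (rule assms)
  have sym: "sym_tensor_op t shift (cadjoint shift) x = T x" if "x \<in> sgn_space 1" for x
    using that by (simp add: sym_tensor_op_def sym_space_eq)
  have alt: "alt_tensor_op t shift (cadjoint shift) x = T x" if "x \<in> sgn_space (- 1)" for x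
    using that by (simp add: alt_tensor_op_def alt_space_eq)
  show ?thesis
    \<comment> \<open>Multisets are functions, hence compared pointwise; the family lemmas then turn
      each conjunct into an instance of \<open>mean_on_sgn_space\<close>.\<close>
    unfolding sym_space_eq alt_space_eq fun_eq_iff sym_family alt_family
    by (intro conjI allI mean_on_sgn_space) (simp_all add: sym alt)
qed

end
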